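(* Let $\Gamma_1=(G_1,\sigma_1)$ be a signed bipartite graph of order $n$ with bipartition $(V_1,V_2)$ and $\Gamma_2=(G_2,\sigma_2)$ be a signed graph of order $m$. If $\lambda^2$ is an eigenvalue of $A(\Gamma_1)^2$ with multiplicity $p$ and $\mu^2$ is an eigenvalue of $A(\Gamma_2)^2$ with multiplicity $q$, then each of the following holds. (i) $\lambda^2+\mu^2$ (resp. $(\lambda^2+1)\mu^2$) is an eigenvalue of $A(\Gamma_1\widetilde{\Box}\Gamma_2)^2$ (resp. $A(\Gamma_1\widetilde{\bowtie}\Gamma_2)^2$) with multiplicity $pq$. (ii) If $\lambda=0$ and $\mu\neq0$, then $\pm\mu$ are eigenvalues of $\Gamma_1\widetilde{\Box}\Gamma_2$ (also of $\Gamma_1\widetilde{\bowtie}\Gamma_2$) with multiplicities $\frac12pq\pm\frac12(n-2|V_1|)(q-2t)$ respectively, where $t$ is the multiplicity of the eigenvalue $\mu$ of $A(\Gamma_2)$. (iii) If $\lambda\neq0$, then $\pm\sqrt{\lambda^2+\mu^2}$ are eigenvalues of $\Gamma_1\widetilde{\Box}\Gamma_2$, each with multiplicity $pq/2$. (iv) If $\lambda\mu\neq0$, then $\pm\sqrt{(\lambda^2+1)\mu^2}$ are eigenvalues of $\Gamma_1\widetilde{\bowtie}\Gamma_2$, each with multiplicity $pq/2$.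
   Context: A signed graph $\Gamma=(G,\sigma)$ is a finite simple undirected graph $G$ together with a map $\sigma:E(G)\to\{+1,-1\}$. Its adjacency matrix $A(\Gamma)$ is the real symmetric matrix indexed by $V(G)$ whose $(u,v)$ entry is $\sigma(uv)$ if $u,v$ are adjacent and $0$ otherwise. The eigenvalues of $\Gamma$ are those of $A(\Gamma)$. Graph notions (order, bipartite) refer to $G$. Here $\lambda,\mu$ are real numbers. Let $\Gamma_1$ be a signed bipartite graph of order $n$ with bipartition $(V_1,V_2)$, $|V_1|=s$. Labeling the vertices of $V_1$ first, $A(\Gamma_1)=\begin{bmatrix}O_s&P\\P^T&O_{n-s}\end{bmatrix}$. For a signed graph $\Gamma_2$ of order $m$, the signed Cartesian product $\Gamma_1\widetilde{\Box}\Gamma_2$ and the signed semi-strong product $\Gamma_1\widetilde{\bowtie}\Gamma_2$ are the signed graphs on $V(G_1)\times V(G_2)$ with adjacency matrices $$A(\Gamma_1\widetilde{\Box}\Gamma_2)=A(\Gamma_1)\otimes I_m+\begin{bmatrix}I_s&O\\O&-I_{n-s}\end{bmatrix}\otimes A(\Gamma_2),\qquad A(\Gamma_1\widetilde{\bowtie}\Gamma_2)=\begin{bmatrix}I_s&P\\P^T&-I_{n-s}\end{bmatrix}\otimes A(\Gamma_2),$$ where $\otimes$ is the Kronecker product and $I_k$ is the identity matrix of order $k$.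
   Formalization: Multiplicities in (i)-(iv) count what the pair (λ²,μ²) contributes, contributions of all pairs adding up; they are total multiplicities only if no other pair of eigenvalues gives the same value (else false, e.g. 1+4=4+1). In (ii), multiplicity 0 means not an eigenvalue. *)

theory Defs
  imports "HOL-Analysis.Analysis"
begin

section \<open>Signed graphs\<close>

text \<open>
  The vertex set is the whole of a finite type, so the order of the graph is the
  cardinality of that type. A signed graph is a pair of an edge set and a sign function; the
  values of the sign function outside the edge set are irrelevant.
\<close>

type_synonym 'v signed_graph = "'v set set \<times> ('v set \<Rightarrow> int)"

definition signed_graph :: "'v::finite signed_graph \<Rightarrow> bool" where
  "signed_graph \<Gamma> \<longleftrightarrow> (\<forall>e \<in> fst \<Gamma>. card e = 2) \<and> (\<forall>e \<in> fst \<Gamma>. snd \<Gamma> e \<in> {1, -1})"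

definition adj_matrix :: "'v::finite signed_graph \<Rightarrow> real^'v^'v" where
  "adj_matrix \<Gamma> = (\<chi> u v. if {u, v} \<in> fst \<Gamma> then of_int (snd \<Gamma> {u, v}) else 0)"

definition bipartition :: "'v::finite signed_graph \<Rightarrow> 'v set \<Rightarrow> 'v set \<Rightarrow> bool" where
  "bipartition \<Gamma> V\<^sub>1 V\<^sub>2 \<longleftrightarrow> V\<^sub>1 \<union> V\<^sub>2 = UNIV \<and> V\<^sub>1 \<inter> V\<^sub>2 = {} \<and>
     (\<forall>e \<in> fst \<Gamma>. \<exists>u \<in> V\<^sub>1. \<exists>v \<in> V\<^sub>2. e = {u, v})"

text \<open>
  The signed graph with a prescribed adjacency matrix; meaningful for symmetric matrices with
  zero diagonal and entries \<open>0, 1, -1\<close> (\<open>signed_adjacency\<close>).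
\<close>

definition graph_of_matrix :: "real^'v^'v \<Rightarrow> 'v::finite signed_graph" where
  "graph_of_matrix M =
     ({{u, v} | u v. M $ u $ v \<noteq> 0},
      \<lambda>e. if \<exists>u v. e = {u, v} \<and> M $ u $ v = 1 then 1 else -1)"

definition signed_adjacency :: "real^'v^'v \<Rightarrow> bool" where
  "signed_adjacency M \<longleftrightarrow> (\<forall>u v. M $ u $ v = M $ v $ u) \<and> (\<forall>u. M $ u $ u = 0) \<and>
     (\<forall>u v. M $ u $ v \<in> {0, 1, -1})"

lemma signed_graph_graph_of_matrix:
  fixes M :: "real^'v::finite^'v"
  assumes "signed_adjacency M"
  shows "signed_graph (graph_of_matrix M)"
  using assms unfolding signed_graph_def signed_adjacency_def graph_of_matrix_def
  by (auto simp: card_2_iff) metis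

lemma adj_matrix_graph_of_matrix:
  fixes M :: "real^'v::finite^'v"
  assumes "signed_adjacency M"
  shows "adj_matrix (graph_of_matrix M) = M"
proof -
  have sym: "M $ u $ v = M $ v $ u" and ent: "M $ u $ v = 0 \<or> M $ u $ v = 1 \<or> M $ u $ v = -1" for u v
    using assms unfolding signed_adjacency_def by auto
  have edge: "{u, v} \<in> fst (graph_of_matrix M) \<longleftrightarrow> M $ u $ v \<noteq> 0" for u v
    unfolding graph_of_matrix_def by (auto simp: doubleton_eq_iff sym)
  have sign: "snd (graph_of_matrix M) {u, v} = (if M $ u $ v = 1 then 1 else -1)" for u v
    unfolding graph_of_matrix_def by (auto simp: doubleton_eq_iff) (metis sym)
  show ?thesis
    unfolding adj_matrix_def vec_eq_iff edge sign using ent by auto (metis ent)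
qed

section \<open>The two products\<close>

definition kronecker :: "real^'a^'a \<Rightarrow> real^'b^'b \<Rightarrow> real^('a \<times> 'b)^('a::finite \<times> 'b::finite)" where
  "kronecker A B = (\<chi> i j. A $ fst i $ fst j * B $ snd i $ snd j)"

text \<open>
  \<open>part_matrix V\<^sub>1\<close> is the block matrix with diagonal blocks \<open>I\<close> and \<open>-I\<close> once the vertices of
  \<open>V\<^sub>1\<close> are labelled first. For a bipartite graph,
  \<open>adj_matrix \<Gamma>\<^sub>1 + part_matrix V\<^sub>1\<close> is the block matrix with rows \<open>[I, P]\<close> and \<open>[P\<^sup>T, -I]\<close>.
\<close>

definition part_matrix :: "'a::finite set \<Rightarrow> real^'a^'a" where
  "part_matrix V\<^sub>1 = (\<chi> u v. if u = v then (if u \<in> V\<^sub>1 then 1 else -1) else 0)"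

definition signed_cartesian ::
    "'a::finite signed_graph \<Rightarrow> 'a set \<Rightarrow> 'b::finite signed_graph \<Rightarrow> ('a \<times> 'b) signed_graph" where
  "signed_cartesian \<Gamma>\<^sub>1 V\<^sub>1 \<Gamma>\<^sub>2 =
     graph_of_matrix (kronecker (adj_matrix \<Gamma>\<^sub>1) (mat 1) + kronecker (part_matrix V\<^sub>1) (adj_matrix \<Gamma>\<^sub>2))"

definition signed_semistrong ::
    "'a::finite signed_graph \<Rightarrow> 'a set \<Rightarrow> 'b::finite signed_graph \<Rightarrow> ('a \<times> 'b) signed_graph" where
  "signed_semistrong \<Gamma>\<^sub>1 V\<^sub>1 \<Gamma>\<^sub>2 =
     graph_of_matrix (kronecker (adj_matrix \<Gamma>\<^sub>1 + part_matrix V\<^sub>1) (adj_matrix \<Gamma>\<^sub>2))"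

lemma adj_matrix_sym: "adj_matrix \<Gamma> $ u $ v = adj_matrix \<Gamma> $ v $ u"
  by (simp add: adj_matrix_def insert_commute)

lemma adj_matrix_diag: "signed_graph \<Gamma> \<Longrightarrow> adj_matrix \<Gamma> $ u $ u = 0"
  unfolding adj_matrix_def signed_graph_def by fastforce

lemma adj_matrix_entries:
  "signed_graph \<Gamma> \<Longrightarrow> adj_matrix \<Gamma> $ u $ v = 0 \<or> adj_matrix \<Gamma> $ u $ v = 1 \<or> adj_matrix \<Gamma> $ u $ v = -1"
  by (cases "{u, v} \<in> fst \<Gamma>") (auto simp: adj_matrix_def signed_graph_def)

lemma signed_adjacency_cartesian:
  assumes "signed_graph \<Gamma>\<^sub>1" "signed_graph \<Gamma>\<^sub>2"
  shows "signed_adjacency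
    (kronecker (adj_matrix \<Gamma>\<^sub>1) (mat 1) + kronecker (part_matrix V\<^sub>1) (adj_matrix \<Gamma>\<^sub>2))"
  using adj_matrix_entries[OF assms(1)] adj_matrix_entries[OF assms(2)]
  unfolding signed_adjacency_def kronecker_def part_matrix_def mat_def
  by (auto simp: adj_matrix_diag[OF assms(1)] adj_matrix_diag[OF assms(2)] adj_matrix_sym)

lemma signed_adjacency_semistrong:
  assumes "signed_graph \<Gamma>\<^sub>1" "signed_graph \<Gamma>\<^sub>2"
  shows "signed_adjacency (kronecker (adj_matrix \<Gamma>\<^sub>1 + part_matrix V\<^sub>1) (adj_matrix \<Gamma>\<^sub>2))"
proof -
  let ?B = "adj_matrix \<Gamma>\<^sub>1 + part_matrix V\<^sub>1"
  have ent: "?B $ u $ v \<in> {0, 1, -1}" and sym: "?B $ u $ v = ?B $ v $ u" for u v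
    using adj_matrix_entries[OF assms(1), of u v] adj_matrix_diag[OF assms(1), of u]
      adj_matrix_sym[of \<Gamma>\<^sub>1 u v]
    by (auto simp: part_matrix_def)
  have "?B $ u $ v * adj_matrix \<Gamma>\<^sub>2 $ x $ y \<in> {0, 1, -1}" for u v x y
    using ent[of u v] adj_matrix_entries[OF assms(2), of x y] by auto
  then show ?thesis
    unfolding signed_adjacency_def kronecker_def
    using sym adj_matrix_sym[of \<Gamma>\<^sub>2] adj_matrix_diag[OF assms(2)]
    by (simp del: plus_vec_def vector_add_component insert_iff)
qed

lemma adj_matrix_signed_cartesian:
  assumes "signed_graph \<Gamma>\<^sub>1" "signed_graph \<Gamma>\<^sub>2"
  shows "signed_graph (signed_cartesian \<Gamma>\<^sub>1 V\<^sub>1 \<Gamma>\<^sub>2)"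
    and "adj_matrix (signed_cartesian \<Gamma>\<^sub>1 V\<^sub>1 \<Gamma>\<^sub>2) =
      kronecker (adj_matrix \<Gamma>\<^sub>1) (mat 1) + kronecker (part_matrix V\<^sub>1) (adj_matrix \<Gamma>\<^sub>2)"
  using signed_adjacency_cartesian[OF assms]
  by (simp_all add: signed_cartesian_def signed_graph_graph_of_matrix adj_matrix_graph_of_matrix)

lemma adj_matrix_signed_semistrong:
  assumes "signed_graph \<Gamma>\<^sub>1" "signed_graph \<Gamma>\<^sub>2"
  shows "signed_graph (signed_semistrong \<Gamma>\<^sub>1 V\<^sub>1 \<Gamma>\<^sub>2)"
    and "adj_matrix (signed_semistrong \<Gamma>\<^sub>1 V\<^sub>1 \<Gamma>\<^sub>2) =
      kronecker (adj_matrix \<Gamma>\<^sub>1 + part_matrix V\<^sub>1) (adj_matrix \<Gamma>\<^sub>2)"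
  using signed_adjacency_semistrong[OF assms]
  by (simp_all add: signed_semistrong_def signed_graph_graph_of_matrix adj_matrix_graph_of_matrix)

section \<open>Eigenvalues and multiplicities\<close>

definition eigenspace :: "real^'n^'n \<Rightarrow> real \<Rightarrow> (real^'n) set" where
  "eigenspace M x = {v. M *v v = x *\<^sub>R v}"

definition eigenvalue :: "real^'n^'n \<Rightarrow> real \<Rightarrow> bool" where
  "eigenvalue M x \<longleftrightarrow> (\<exists>v \<in> eigenspace M x. v \<noteq> 0)"

text \<open>
  All matrices below are real symmetric, so geometric and algebraic multiplicities agree. The
  multiplicity is 0 if the number is not an eigenvalue.
\<close>

definition eig_mult :: "real^'n^'n \<Rightarrow> real \<Rightarrow> nat" where
  "eig_mult M x = dim (eigenspace M x)"

definition tensor_space ::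
    "(real^'a) set \<Rightarrow> (real^'b) set \<Rightarrow> (real^('a::finite \<times> 'b::finite)) set" where
  "tensor_space U W = span {(\<chi> i. x $ fst i * y $ snd i) | x y. x \<in> U \<and> y \<in> W}"

text \<open>
  The multiplicity of \<open>x\<close> as an eigenvalue of \<open>M\<close> that comes from the eigenvalue \<open>a\<close> of \<open>A\<^sup>2\<close> and
  the eigenvalue \<open>b\<close> of \<open>B\<^sup>2\<close>, i.e. the multiplicity for the restriction of \<open>M\<close> to the tensor
  product of the two eigenspaces. Different pairs \<open>(a, b)\<close> may yield the same eigenvalue
  (e.g. \<open>1 + 4 = 4 + 1\<close>); then these contributions add up to the multiplicity in \<open>M\<close>.
\<close>

definition eig_mult_from ::
    "real^'a^'a \<Rightarrow> real^'b^'b \<Rightarrow> real \<Rightarrow> real \<Rightarrow>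
     real^('a \<times> 'b)^('a::finite \<times> 'b::finite) \<Rightarrow> real \<Rightarrow> nat" where
  "eig_mult_from A B a b M x =
     dim (tensor_space (eigenspace (A ** A) a) (eigenspace (B ** B) b) \<inter> eigenspace M x)"

end

(*
  Write A, B for the adjacency matrices of the two factors and D for the diagonal matrix of the
  bipartition. Bipartiteness means D A = - A D, whence (A (x) 1 + D (x) B)^2 = A^2 (x) 1 + 1 (x) B^2
  and ((A + D) (x) B)^2 = (A^2 + 1) (x) B^2. Both squares are therefore scalar on the tensor
  product W of an eigenspace of A^2 and one of B^2. If the eigenvalue of A^2 is nonzero, then
  A D (x) 1 is invertible on W and anticommutes with both products, so the eigenvalues +nu and -nu
  are equally frequent on W. On the kernel of A both products act as D (x) B, and the signature of
  D on the kernel of A is its signature on the whole space, 2 |V_1| - n.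
*)
theory Submission
  imports Defs
begin

section \<open>Symmetric matrices\<close>

text \<open>The sign-reversing map cannot be simpler. \<open>kronecker D (mat 1)\<close> and
  \<open>kronecker A (mat 1)\<close> each anticommute with one summand of the Cartesian product but
  commute with the other. \<open>A ** D\<close> anticommutes with both \<open>A\<close> and
  \<open>D\<close>, and its square is \<open>- (A ** A)\<close>; so it is injective wherever
  \<open>A ** A\<close> is a nonzero scalar and gives nothing on the kernel. The kernel needs its
  own count, and this is where the asymmetric term of (ii) comes from. A total multiplicity
  \<open>p * q\<close> can fail when two pairs of eigenvalues yield the same value. The arguments
  therefore stay inside one joint eigenspace \<open>W a b\<close>, and totals are recovered by
  summing over all pairs. Everything is a comparison of dimensions, resting on one counting lemma
  for a symmetric matrix on an invariant subspace; it is applied to the products, to the squares of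
  the factors and to \<open>D\<close> alike.\<close>

lemma subspace_eigenspace: "subspace (eigenspace M x)"
  by (auto simp: subspace_def eigenspace_def matrix_vector_right_distrib scaleR_right_distrib
      matrix_vector_mult_scaleR)

lemma inner_symmetric_matrix:
  fixes M :: "real^'n^'n"
  assumes "transpose M = M"
  shows "(M *v x) \<bullet> y = x \<bullet> (M *v y)"
  using assms by (metis dot_lmul_matrix transpose_matrix_vector)

text \<open>Maximise the Rayleigh quotient over the unit sphere of \<open>H\<close>. Invariance
  keeps the residual \<open>z\<close> of the maximiser \<open>u\<close> in \<open>H\<close>, and
  moving from \<open>u\<close> towards \<open>z\<close> would raise the quotient to first order
  unless \<open>z = 0\<close>.\<close>

lemma symmetric_invariant_eigenvector:
  fixes M :: "real^'n^'n"
  assumes sym: "transpose M = M" and H: "subspace H" "H \<noteq> {0}"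
    and inv: "\<And>v. v \<in> H \<Longrightarrow> M *v v \<in> H"
  obtains u x where "u \<in> H" "u \<noteq> 0" "M *v u = x *\<^sub>R u"
proof -
  let ?S = "H \<inter> sphere 0 1"
  obtain w where w: "w \<in> H" "w \<noteq> 0"
    using H subspace_0 by blast
  then have "(1 / norm w) *\<^sub>R w \<in> ?S"
    using H(1) by (simp add: subspace_scale)
  then have ne: "?S \<noteq> {}" by blast
  have "compact ?S"
    using H(1) by (simp add: closed_subspace closed_Int_compact)
  moreover have "continuous_on ?S (\<lambda>v. v \<bullet> (M *v v))"
    by (intro continuous_on_inner continuous_on_id matrix_vector_mult_linear_continuous_on)
  ultimately obtain u where u: "u \<in> ?S" and max: "\<And>v. v \<in> ?S \<Longrightarrow> v \<bullet> (M *v v) \<le> u \<bullet> (M *v u)"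
    using continuous_attains_sup[OF _ ne] by blast
  define m where "m = u \<bullet> (M *v u)"
  have uH: "u \<in> H" and un: "u \<bullet> u = 1"
    using u by (auto simp: norm_eq_1)
  have quad: "v \<bullet> (M *v v) \<le> m * (v \<bullet> v)" if v: "v \<in> H" for v
  proof (cases "v = 0")
    case False
    let ?w = "(1 / norm v) *\<^sub>R v"
    have "?w \<in> ?S" using v False H(1) by (simp add: subspace_scale)
    from max[OF this] have "(v \<bullet> (M *v v)) / (norm v)\<^sup>2 \<le> m"
      by (simp add: m_def matrix_vector_mult_scaleR power2_eq_square)
    with False show ?thesis
      by (simp add: power2_norm_eq_inner divide_le_eq)
  qed simp
  define z where "z = M *v u - m *\<^sub>R u"
  have zH: "z \<in> H"
    unfolding z_def using uH inv H(1) by (simp add: subspace_diff subspace_scale)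
  define c where "c = m * (z \<bullet> z) - z \<bullet> (M *v z)"
  have c: "c \<ge> 0" using quad[OF zH] by (simp add: c_def)
  have ineq: "2 * s * (z \<bullet> z) \<le> s\<^sup>2 * c" for s
  proof -
    have "u + s *\<^sub>R z \<in> H" using uH zH H(1) by (simp add: subspace_add subspace_scale)
    from quad[OF this]
    have "m + 2 * s * (z \<bullet> (M *v u)) + s\<^sup>2 * (z \<bullet> (M *v z))
        \<le> m * (1 + 2 * s * (z \<bullet> u) + s\<^sup>2 * (z \<bullet> z))"
      using inner_symmetric_matrix[OF sym, of u z]
      by (simp add: matrix_vector_right_distrib matrix_vector_mult_scaleR inner_add_left
          inner_add_right m_def[symmetric] un power2_eq_square inner_commute algebra_simps)
    moreover have "2 * s * (z \<bullet> z) = 2 * s * (z \<bullet> (M *v u)) - 2 * s * m * (z \<bullet> u)"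
      by (subst (2) z_def) (simp add: inner_diff_right algebra_simps)
    ultimately show ?thesis by (simp add: c_def algebra_simps)
  qed
  have "z \<bullet> z = 0"
  proof (rule ccontr)
    assume "z \<bullet> z \<noteq> 0"
    then have pos: "z \<bullet> z > 0" by simp
    \<comment> \<open>In \<open>ineq\<close> the left side is linear in \<open>s\<close> and the
      right side quadratic, so a small positive \<open>s\<close> refutes it. Dividing by
      \<open>c + 1\<close> covers \<open>c = 0\<close> and gives
      \<open>?s * c \<le> z \<bullet> z\<close>.\<close>
    let ?s = "(z \<bullet> z) / (c + 1)"
    have sp: "?s > 0" using pos c by simp
    have "?s * (2 * (z \<bullet> z)) \<le> ?s * (?s * c)"
      using ineq[of ?s] by (simp add: power2_eq_square algebra_simps)
    then have "2 * (z \<bullet> z) \<le> ?s * c" using sp mult_le_cancel_left_pos by blast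
    also have "\<dots> \<le> z \<bullet> z" using pos c by (simp add: divide_le_eq algebra_simps)
    finally show False using pos by simp
  qed
  then have "M *v u = m *\<^sub>R u" by (simp add: z_def)
  with uH un that show thesis by (metis inner_zero_left zero_neq_one)
qed

section \<open>Decomposition of invariant subspaces into eigenspaces\<close>

lemma orthonormal_dim:
  fixes B :: "'a::euclidean_space set"
  assumes "pairwise orthogonal B" "0 \<notin> B"
  shows "dim (span B) = card B"
  using pairwise_orthogonal_independent[OF assms] by (simp add: dim_eq_card_independent)

lemma symmetric_eigenvectors_orthogonal:
  fixes M :: "real^'n^'n"
  assumes "transpose M = M" "v \<in> eigenspace M x" "w \<in> eigenspace M y" "x \<noteq> y"
  shows "v \<bullet> w = 0"
proof -
  have "x * (v \<bullet> w) = y * (v \<bullet> w)"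
    using inner_symmetric_matrix[OF assms(1), of v w] assms(2,3) by (simp add: eigenspace_def)
  with assms(4) show ?thesis by simp
qed

text \<open>One eigenvector per eigenvalue gives an orthogonal, hence independent, set. The sums
  over all eigenvalues depend on this, since a sum over an infinite set would default to 0.\<close>

lemma finite_eigenvalues_symmetric:
  fixes M :: "real^'n^'n"
  assumes "transpose M = M"
  shows "finite {x. eigenvalue M x}"
proof -
  have "\<forall>x. \<exists>v. eigenvalue M x \<longrightarrow> v \<in> eigenspace M x \<and> v \<noteq> 0"
    by (auto simp: eigenvalue_def)
  then obtain f where f: "\<And>x. eigenvalue M x \<Longrightarrow> f x \<in> eigenspace M x"
      "\<And>x. eigenvalue M x \<Longrightarrow> f x \<noteq> 0"
    by metis
  let ?L = "{x. eigenvalue M x}"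
  have orth: "f x \<bullet> f y = 0" if "x \<in> ?L" "y \<in> ?L" "x \<noteq> y" for x y
    using symmetric_eigenvectors_orthogonal[OF assms] f that by blast
  have "inj_on f ?L"
    using orth f by (metis (no_types, lifting) inj_onI inner_eq_zero_iff mem_Collect_eq)
  moreover have "pairwise orthogonal (f ` ?L)"
    using orth by (auto simp: pairwise_def orthogonal_def)
  then have "independent (f ` ?L)"
    using f(2) by (intro pairwise_orthogonal_independent) auto
  then have "finite (f ` ?L)" using independent_bound by blast
  ultimately show ?thesis using finite_image_iff by blast
qed

text \<open>The spectral theorem as a dimension count: orthonormal bases of the pieces for different
  eigenvalues are mutually orthogonal, and their union spans \<open>F\<close>. \<open>L\<close> may
  be any finite superset of the eigenvalues on \<open>F\<close>, as a surplus element contributes 0;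
  later it is \<open>{x, - x}\<close> or the spectrum of a factor.\<close>

lemma symmetric_invariant_dim_sum:
  fixes M :: "real^'n^'n"
  assumes sym: "transpose M = M" and F: "subspace F"
    and inv: "\<And>v. v \<in> F \<Longrightarrow> M *v v \<in> F"
    and L: "finite L" "\<And>v x. v \<in> F \<Longrightarrow> v \<noteq> 0 \<Longrightarrow> M *v v = x *\<^sub>R v \<Longrightarrow> x \<in> L"
  shows "dim F = (\<Sum>x\<in>L. dim (F \<inter> eigenspace M x))"
proof -
  have "\<exists>B. B \<subseteq> F \<inter> eigenspace M x \<and> pairwise orthogonal B \<and> 0 \<notin> B \<and>
      card B = dim (F \<inter> eigenspace M x) \<and> span B = F \<inter> eigenspace M x" for x
  proof -
    have "subspace (F \<inter> eigenspace M x)"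
      using F subspace_eigenspace by (rule subspace_inter)
    then obtain B where "B \<subseteq> F \<inter> eigenspace M x" "pairwise orthogonal B"
      "\<And>v. v \<in> B \<Longrightarrow> norm v = 1" "card B = dim (F \<inter> eigenspace M x)"
      "span B = F \<inter> eigenspace M x"
      using orthonormal_basis_subspace by metis
    then show ?thesis by (metis norm_zero zero_neq_one)
  qed
  then obtain B where B: "\<And>x. B x \<subseteq> F \<inter> eigenspace M x" "\<And>x. pairwise orthogonal (B x)"
    "\<And>x. 0 \<notin> B x" "\<And>x. card (B x) = dim (F \<inter> eigenspace M x)"
    "\<And>x. span (B x) = F \<inter> eigenspace M x"
    by metis
  note orth = symmetric_eigenvectors_orthogonal[OF sym]
  define U where "U = (\<Union>x\<in>L. B x)"
  have fin: "finite (B x)" for x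
    using pairwise_orthogonal_independent[OF B(2,3)] independent_bound by blast
  have UF: "U \<subseteq> F" using B(1) by (auto simp: U_def)
  have U0: "0 \<notin> U" using B(3) by (auto simp: U_def)
  have disj: "B x \<inter> B y = {}" if "x \<noteq> y" for x y
  proof -
    have "v = 0" if "v \<in> B x" "v \<in> B y" for v
      using B(1)[of x] B(1)[of y] that orth[of v x v y] \<open>x \<noteq> y\<close> by auto
    then show ?thesis using B(3) by blast
  qed
  have Uorth: "pairwise orthogonal U"
    unfolding pairwise_def U_def orthogonal_def
  proof safe
    fix x y v w assume "v \<in> B x" "w \<in> B y" "v \<noteq> w"
    then show "v \<bullet> w = 0"
      using B(1)[of x] B(1)[of y] B(2)[of x] orth[of v x w y]
      by (cases "x = y") (auto 4 4 simp: pairwise_def orthogonal_def)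
  qed
  have "span U = F"
  proof (rule ccontr)
    assume ne: "span U \<noteq> F"
    have sub: "span U \<subset> F" using UF F ne span_minimal by blast
    \<comment> \<open>The orthogonal complement of \<open>U\<close> in \<open>F\<close> would be
      nonzero and invariant. An eigenvector in it also lies in some \<open>span (B x)\<close>, hence
      is orthogonal to itself.\<close>
    let ?H = "{v \<in> F. \<forall>w\<in>U. w \<bullet> v = 0}"
    obtain z where z: "z \<noteq> 0" "z \<in> span F" "\<And>y. y \<in> span (span U) \<Longrightarrow> orthogonal z y"
      using orthogonal_to_subspace_exists_gen[of "span U" F] sub F
      by (auto simp: span_eq_iff[THEN iffD2])
    then have "z \<in> ?H"
      using F by (auto simp: orthogonal_def inner_commute span_base span_eq_iff[THEN iffD2])
    then have Hne: "?H \<noteq> {0}" using z(1) by blast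
    have Hsub: "subspace ?H"
      using F by (auto simp: subspace_def inner_add_right)
    have Hinv: "M *v v \<in> ?H" if v: "v \<in> ?H" for v
    proof -
      have "w \<bullet> (M *v v) = 0" if w: "w \<in> U" for w
      proof -
        obtain x where "w \<in> B x" using w by (auto simp: U_def)
        then have "M *v w = x *\<^sub>R w" using B(1)[of x] by (auto simp: eigenspace_def)
        then show ?thesis using inner_symmetric_matrix[OF sym, of w v] v w by simp
      qed
      with v inv show ?thesis by simp
    qed
    obtain u x where u: "u \<in> ?H" "u \<noteq> 0" "M *v u = x *\<^sub>R u"
      using symmetric_invariant_eigenvector[OF sym Hsub Hne Hinv] .
    then have "x \<in> L" using L(2) by blast
    have "u \<in> span (B x)" using u B(5)[of x] by (simp add: eigenspace_def)
    with \<open>x \<in> L\<close> have "u \<in> span U" unfolding U_def by (meson UN_upper span_mono subsetD)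
    moreover have "orthogonal u y" if "y \<in> span U" for y
      using orthogonal_to_span[OF that] u(1) by (simp add: orthogonal_def inner_commute)
    ultimately have "orthogonal u u" by blast
    then show False using u(2) by (simp add: orthogonal_self)
  qed
  then have "dim F = card U" using orthonormal_dim[OF Uorth U0] by simp
  also have "\<dots> = (\<Sum>x\<in>L. card (B x))"
    unfolding U_def using L(1) fin disj by (intro card_UN_disjoint) auto
  finally show ?thesis by (simp add: B(4))
qed

section \<open>Tensor and Kronecker products\<close>

definition tensor :: "real^'a \<Rightarrow> real^'b \<Rightarrow> real^('a::finite \<times> 'b::finite)" where
  "tensor x y = (\<chi> i. x $ fst i * y $ snd i)"

text \<open>With \<open>v\<close> read as a matrix, \<open>slice_fst j\<close> is column
  \<open>j\<close> and \<open>slice_snd i\<close> is row \<open>i\<close>. A Kronecker product with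
  one factor \<open>mat 1\<close> acts on the columns, or on the rows, one at a time.\<close>

definition slice_fst :: "'b \<Rightarrow> real^('a::finite \<times> 'b::finite) \<Rightarrow> real^'a" where
  "slice_fst j v = (\<chi> i. v $ (i, j))"

definition slice_snd :: "'a \<Rightarrow> real^('a::finite \<times> 'b::finite) \<Rightarrow> real^'b" where
  "slice_snd i v = (\<chi> j. v $ (i, j))"

lemma linear_slice_fst: "linear (slice_fst j)"
  by (rule linearI) (simp_all add: slice_fst_def vec_eq_iff)

lemma linear_slice_snd: "linear (slice_snd i)"
  by (rule linearI) (simp_all add: slice_snd_def vec_eq_iff)

lemma linear_tensor_left: "linear (\<lambda>x. tensor x y)"
  by (rule linearI) (simp_all add: tensor_def vec_eq_iff algebra_simps)

lemma linear_tensor_right: "linear (tensor x)"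
  by (rule linearI) (simp_all add: tensor_def vec_eq_iff algebra_simps)

lemma slice_fst_tensor: "slice_fst j (tensor x y) = y $ j *\<^sub>R x"
  by (simp add: slice_fst_def tensor_def vec_eq_iff)

lemma slice_snd_tensor: "slice_snd i (tensor x y) = x $ i *\<^sub>R y"
  by (simp add: slice_snd_def tensor_def vec_eq_iff)

lemma slice_fst_eqI: "(\<And>j. slice_fst j v = slice_fst j w) \<Longrightarrow> v = w"
  by (simp add: slice_fst_def vec_eq_iff)

lemma slice_snd_eqI: "(\<And>i. slice_snd i v = slice_snd i w) \<Longrightarrow> v = w"
  by (simp add: slice_snd_def vec_eq_iff)

lemma inner_tensor: "tensor x y \<bullet> tensor x' y' = (x \<bullet> x') * (y \<bullet> y')"
  by (simp add: tensor_def inner_vec_def sum_product sum.cartesian_product algebra_simps split_def)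

lemma tensor_space_conv: "tensor_space U W = span ((\<lambda>(x, y). tensor x y) ` (U \<times> W))"
  unfolding tensor_space_def tensor_def by (rule arg_cong[of _ _ span]) auto

text \<open>A membership test free of spans. Expanding every column in an orthonormal basis
  \<open>E\<close> of \<open>U\<close> writes \<open>v\<close> as the sum of the
  \<open>tensor e (c e)\<close>; each \<open>c e\<close> is a linear combination of rows of
  \<open>v\<close>, so it lies in \<open>W\<close>.\<close>

lemma tensor_space_eq_slices:
  assumes U: "subspace U" and W: "subspace W"
  shows "tensor_space U W = {v. (\<forall>j. slice_fst j v \<in> U) \<and> (\<forall>i. slice_snd i v \<in> W)}" (is "_ = ?R")
proof
  have "subspace ?R"
    using U W unfolding subspace_def
    by (auto simp: linear_add[OF linear_slice_fst] linear_add[OF linear_slice_snd]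
        linear_0[OF linear_slice_fst] linear_0[OF linear_slice_snd]
        linear_scale[OF linear_slice_fst] linear_scale[OF linear_slice_snd])
  moreover have "(\<lambda>(x, y). tensor x y) ` (U \<times> W) \<subseteq> ?R"
    using U W by (auto simp: slice_fst_tensor slice_snd_tensor subspace_scale)
  ultimately show "tensor_space U W \<subseteq> ?R"
    unfolding tensor_space_conv by (rule span_minimal[rotated])
next
  obtain E where E: "E \<subseteq> U" "pairwise orthogonal E" "\<And>e. e \<in> E \<Longrightarrow> norm e = 1"
    "independent E" "span E = U"
    using orthonormal_basis_subspace[OF U] by metis
  have fin: "finite E" using E(4) independent_bound by blast
  show "?R \<subseteq> tensor_space U W"
  proof
    fix v assume "v \<in> ?R"
    then have vU: "slice_fst j v \<in> U" and vW: "slice_snd i v \<in> W" for i j by auto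
    define c where "c e = (\<chi> j. slice_fst j v \<bullet> e)" for e
    have "c e = (\<Sum>i\<in>UNIV. e $ i *\<^sub>R slice_snd i v)" for e
      by (simp add: c_def vec_eq_iff slice_fst_def slice_snd_def inner_vec_def mult.commute)
    then have cW: "c e \<in> W" for e
      using W vW by (simp add: subspace_sum subspace_scale)
    have "v = (\<Sum>e\<in>E. tensor e (c e))"
    proof (rule slice_fst_eqI)
      fix j
      have "slice_fst j v = (\<Sum>e\<in>E. (slice_fst j v \<bullet> e) *\<^sub>R e)"
        using orthonormal_basis_expand[OF E(2,3) _ fin] vU E(5) by simp
      then show "slice_fst j v = slice_fst j (\<Sum>e\<in>E. tensor e (c e))"
        by (simp add: linear_sum[OF linear_slice_fst] slice_fst_tensor c_def)
    qed
    also have "\<dots> \<in> tensor_space U W"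
      unfolding tensor_space_conv using E(1) cW by (intro span_sum span_base) auto
    finally show "v \<in> tensor_space U W" .
  qed
qed

text \<open>Inner products of tensors multiply, so the tensors of two orthonormal bases are
  orthonormal; injectivity and independence both follow from this.\<close>

lemma dim_tensor_space:
  assumes U: "subspace U" and W: "subspace W"
  shows "dim (tensor_space U W) = dim U * dim W"
proof -
  obtain E where E: "E \<subseteq> U" "pairwise orthogonal E" "\<And>e. e \<in> E \<Longrightarrow> norm e = 1"
    "card E = dim U" "span E = U"
    using orthonormal_basis_subspace[OF U] by metis
  obtain F where F: "F \<subseteq> W" "pairwise orthogonal F" "\<And>e. e \<in> F \<Longrightarrow> norm e = 1"
    "card F = dim W" "span F = W"
    using orthonormal_basis_subspace[OF W] by metis
  let ?T = "(\<lambda>(x, y). tensor x y) ` (E \<times> F)"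
  have inner_E: "e \<bullet> e' = (if e = e' then 1 else 0)" if "e \<in> E" "e' \<in> E" for e e'
    using E(2,3) that by (auto simp: pairwise_def orthogonal_def norm_eq_1)
  have inner_F: "e \<bullet> e' = (if e = e' then 1 else 0)" if "e \<in> F" "e' \<in> F" for e e'
    using F(2,3) that by (auto simp: pairwise_def orthogonal_def norm_eq_1)
  have inner_T: "tensor e f \<bullet> tensor e' f' = (if e = e' \<and> f = f' then 1 else 0)"
    if "e \<in> E" "e' \<in> E" "f \<in> F" "f' \<in> F" for e e' f f'
    using that by (simp add: inner_tensor inner_E inner_F)
  have inj: "inj_on (\<lambda>(x, y). tensor x y) (E \<times> F)"
  proof (rule inj_onI, safe)
    fix e f e' f' assume *: "e \<in> E" "f \<in> F" "e' \<in> E" "f' \<in> F" "tensor e f = tensor e' f'"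
    then show "e = e'" "f = f'"
      using inner_T[of e e f f] inner_T[of e e' f f'] by (auto split: if_splits)
  qed
  have orth: "pairwise orthogonal ?T"
    by (auto simp: pairwise_def orthogonal_def inner_T)
  have "0 \<notin> ?T"
  proof
    assume "0 \<in> ?T"
    then obtain e f where *: "e \<in> E" "f \<in> F" "tensor e f = 0" by auto
    with inner_T[of e e f f] show False by simp
  qed
  with orth have "dim (span ?T) = card ?T" by (rule orthonormal_dim)
  also have "\<dots> = dim U * dim W"
    using inj E(4) F(4) by (simp add: card_image card_cartesian_product)
  also have "span ?T = tensor_space U W"
  proof
    show "span ?T \<subseteq> tensor_space U W"
      unfolding tensor_space_conv using E(1) F(1) by (intro span_mono image_mono) auto
    \<comment> \<open>Bilinearity in two stages: first a basis vector \<open>e\<close> with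
      arbitrary \<open>y\<close>, then arbitrary \<open>x\<close>.\<close>
    have "tensor x y \<in> span ?T" if x: "x \<in> U" and y: "y \<in> W" for x y
    proof -
      have "tensor e y \<in> span ?T" if e: "e \<in> E" for e
      proof -
        have "tensor e y \<in> tensor e ` span F" using y F(5) by simp
        also have "\<dots> = span (tensor e ` F)"
          by (rule linear_span_image[OF linear_tensor_right, symmetric])
        also have "\<dots> \<subseteq> span ?T" using e by (intro span_mono) auto
        finally show ?thesis .
      qed
      then have "span ((\<lambda>x. tensor x y) ` E) \<subseteq> span ?T"
        by (intro span_minimal) auto
      moreover have "tensor x y \<in> (\<lambda>x. tensor x y) ` span E" using x E(5) by simp
      ultimately show ?thesis
        using linear_span_image[OF linear_tensor_left] by blast
    qed
    then show "tensor_space U W \<subseteq> span ?T"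
      unfolding tensor_space_conv by (intro span_minimal) auto
  qed
  finally show ?thesis .
qed

section \<open>Kronecker products and their eigenspaces\<close>

lemma kronecker_mult: "kronecker A B ** kronecker A' B' = kronecker (A ** A') (B ** B')"
  by (simp add: kronecker_def matrix_matrix_mult_def vec_eq_iff sum_product
      sum.cartesian_product split_def algebra_simps)

lemma kronecker_add_left: "kronecker (A + A') B = kronecker A B + kronecker A' B"
  by (simp add: kronecker_def vec_eq_iff algebra_simps)

lemma kronecker_minus_left: "kronecker (- A) B = - kronecker A B"
  by (simp add: kronecker_def vec_eq_iff)

lemma transpose_kronecker: "transpose (kronecker A B) = kronecker (transpose A) (transpose B)"
  by (simp add: kronecker_def vec_eq_iff transpose_def)

lemma kronecker_mat_1: "kronecker (mat 1) (mat 1) = mat 1"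
  by (simp add: kronecker_def vec_eq_iff mat_def prod_eq_iff)

lemma sum_UNIV_prod:
  fixes f :: "'a::finite \<times> 'b::finite \<Rightarrow> 'c::comm_monoid_add"
  shows "(\<Sum>i\<in>UNIV. f i) = (\<Sum>a\<in>UNIV. \<Sum>b\<in>UNIV. f (a, b))"
  by (simp add: sum.cartesian_product)

lemma slice_fst_kronecker:
  "slice_fst j (kronecker A (mat 1) *v v) = A *v slice_fst j v"
  by (simp add: slice_fst_def kronecker_def matrix_vector_mult_def mat_def vec_eq_iff
      sum_UNIV_prod mult_delta_left mult_delta_right)

lemma slice_snd_kronecker:
  "slice_snd i (kronecker (mat 1) B *v v) = B *v slice_snd i v"
  unfolding slice_snd_def kronecker_def matrix_vector_mult_def mat_def vec_eq_iff sum_UNIV_prod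
  \<comment> \<open>The delta from \<open>mat 1\<close> sits in the outer sum; once swapped inside
    it collapses.\<close>
  by (subst sum.swap) (simp add: mult_delta_left mult_delta_right)

lemma eigenspace_kronecker_left:
  "v \<in> eigenspace (kronecker A (mat 1)) x \<longleftrightarrow> (\<forall>j. slice_fst j v \<in> eigenspace A x)"
  unfolding eigenspace_def mem_Collect_eq
  using slice_fst_eqI[of "kronecker A (mat 1) *v v" "x *\<^sub>R v"]
  by (auto simp: slice_fst_kronecker linear_scale[OF linear_slice_fst]
      simp flip: slice_fst_kronecker)

lemma eigenspace_kronecker_right:
  "v \<in> eigenspace (kronecker (mat 1) B) x \<longleftrightarrow> (\<forall>i. slice_snd i v \<in> eigenspace B x)"
  unfolding eigenspace_def mem_Collect_eq
  using slice_snd_eqI[of "kronecker (mat 1) B *v v" "x *\<^sub>R v"]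
  by (auto simp: slice_snd_kronecker linear_scale[OF linear_slice_snd]
      simp flip: slice_snd_kronecker)

text \<open>Turns the tensor product into a joint eigenspace of two matrices, so that its invariance
  follows from commutation alone.\<close>

lemma tensor_space_eigenspaces:
  "tensor_space (eigenspace A a) (eigenspace B b) =
    eigenspace (kronecker A (mat 1)) a \<inter> eigenspace (kronecker (mat 1) B) b"
  by (auto simp: tensor_space_eq_slices subspace_eigenspace eigenspace_kronecker_left
      eigenspace_kronecker_right)

text \<open>Some slice of a nonzero vector is nonzero and is itself an eigenvector. Hence sums
  indexed by the eigenvalues of the factors miss nothing.\<close>

lemma eigenvalue_kronecker_left:
  assumes "eigenvalue (kronecker A (mat 1) :: real^('a \<times> 'b)^('a::finite \<times> 'b::finite)) x"
  shows "eigenvalue A x"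
proof -
  obtain v :: "real^('a \<times> 'b)" where v: "v \<in> eigenspace (kronecker A (mat 1)) x" "v \<noteq> 0"
    using assms by (auto simp: eigenvalue_def)
  then obtain j where "slice_fst j v \<noteq> 0"
    using slice_fst_eqI[of v 0] linear_0[OF linear_slice_fst] by metis
  with v(1) show ?thesis by (auto simp: eigenspace_kronecker_left eigenvalue_def)
qed

lemma eigenvalue_kronecker_right:
  assumes "eigenvalue (kronecker (mat 1) B :: real^('a \<times> 'b)^('a::finite \<times> 'b::finite)) x"
  shows "eigenvalue B x"
proof -
  obtain v :: "real^('a \<times> 'b)" where v: "v \<in> eigenspace (kronecker (mat 1) B) x" "v \<noteq> 0"
    using assms by (auto simp: eigenvalue_def)
  then obtain i where "slice_snd i v \<noteq> 0"
    using slice_snd_eqI[of v 0] linear_0[OF linear_slice_snd] by metis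
  with v(1) show ?thesis by (auto simp: eigenspace_kronecker_right eigenvalue_def)
qed

section \<open>Commuting and anticommuting matrices\<close>

lemma matrix_mult_minus_left: "(- A) ** B = - (A ** (B :: real^'n^'m))"
  by (simp add: matrix_matrix_mult_def vec_eq_iff sum_negf)

lemma matrix_mult_minus_right: "A ** (- B) = - (A ** (B :: real^'n^'m))"
  by (simp add: matrix_matrix_mult_def vec_eq_iff sum_negf)

lemma matrix_add_rdistrib: "(A + B) ** C = A ** C + B ** (C :: real^'n^'m)"
  by (simp add: matrix_matrix_mult_def vec_eq_iff sum.distrib algebra_simps)

lemma transpose_add: "transpose (A + B) = transpose A + transpose B"
  by (simp add: transpose_def vec_eq_iff)

lemma matrix_vector_mult_uminus_left: "(- M) *v v = - (M *v (v :: real^'n))"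
  by (simp add: matrix_vector_mult_def vec_eq_iff sum_negf)

lemma eigenspace_commute:
  fixes M T :: "real^'n^'n"
  assumes "T ** M = M ** T" "v \<in> eigenspace M x"
  shows "T *v v \<in> eigenspace M x"
proof -
  have "M *v (T *v v) = T *v (M *v v)"
    by (simp add: matrix_vector_mul_assoc assms(1))
  with assms(2) show ?thesis by (simp add: eigenspace_def matrix_vector_mult_scaleR)
qed

lemma eigenspace_anticommute:
  fixes M T :: "real^'n^'n"
  assumes "T ** M = - (M ** T)" "v \<in> eigenspace M x"
  shows "T *v v \<in> eigenspace M (- x)"
proof -
  have "T *v (M *v v) = - (M *v (T *v v))"
    by (simp add: matrix_vector_mul_assoc assms(1) matrix_vector_mult_uminus_left)
  with assms(2) show ?thesis
    by (simp add: eigenspace_def matrix_vector_mult_scaleR)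
qed

lemma eigenspace_mult_self:
  fixes M :: "real^'n^'n"
  shows "v \<in> eigenspace M x \<Longrightarrow> v \<in> eigenspace (M ** M) (x\<^sup>2)"
  by (simp add: eigenspace_def matrix_vector_mult_scaleR power2_eq_square
      flip: matrix_vector_mul_assoc)

lemma eigenspace_unique: "v \<in> eigenspace M x \<Longrightarrow> v \<in> eigenspace M y \<Longrightarrow> v \<noteq> 0 \<Longrightarrow> x = y"
  by (simp add: eigenspace_def)

lemma eigenvalue_iff_eig_mult: "eigenvalue M x \<longleftrightarrow> eig_mult M x > 0"
  using dim_eq_0[of "eigenspace M x"] by (auto simp: eigenvalue_def eig_mult_def simp del: dim_eq_0)

text \<open>\<open>T\<close> embeds the \<open>x\<close> part of \<open>F\<close> into the
  \<open>- x\<close> part, and likewise backwards. Injectivity is asked on \<open>F\<close> only,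
  because the maps used for \<open>T\<close> are built from \<open>A\<close> and may be singular
  elsewhere.\<close>

lemma dim_eigenspace_anticommute:
  fixes M T :: "real^'n^'n"
  assumes anti: "T ** M = - (M ** T)" and F: "subspace F"
    and inv: "\<And>v. v \<in> F \<Longrightarrow> T *v v \<in> F" and inj: "\<And>v. v \<in> F \<Longrightarrow> T *v v = 0 \<Longrightarrow> v = 0"
  shows "dim (F \<inter> eigenspace M (- x)) = dim (F \<inter> eigenspace M x)"
proof -
  have "dim (F \<inter> eigenspace M x) \<le> dim (F \<inter> eigenspace M (- x))" for x
  proof -
    let ?G = "F \<inter> eigenspace M x"
    have G: "subspace ?G" using F subspace_eigenspace by (rule subspace_inter)
    have "inj_on ((*v) T) ?G"
    proof (rule inj_onI)
      fix v w assume vw: "v \<in> ?G" "w \<in> ?G" "T *v v = T *v w"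
      then have "v - w \<in> F" "T *v (v - w) = 0"
        using F by (auto simp: subspace_diff matrix_vector_mult_diff_distrib)
      with inj have "v - w = 0" by blast
      then show "v = w" by simp
    qed
    then have "dim ?G = dim ((*v) T ` ?G)"
      using G by (intro dim_image_eq[symmetric]) (simp_all add: span_eq_iff[THEN iffD2])
    also have "\<dots> \<le> dim (F \<inter> eigenspace M (- x))"
      using inv eigenspace_anticommute[OF anti] by (intro dim_subset) auto
    finally show ?thesis .
  qed
  from this[of x] this[of "- x"] show ?thesis by simp
qed

text \<open>Every eigenvalue of \<open>M\<close> on \<open>F\<close> has square
  \<open>x\<^sup>2\<close>. The condition \<open>x \<noteq> 0\<close> keeps the two summands apart;
  otherwise \<open>{x, - x}\<close> would be a single point.\<close>

lemma dim_square_split: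
  fixes M :: "real^'n^'n"
  assumes "transpose M = M" "subspace F" "\<And>v. v \<in> F \<Longrightarrow> M *v v \<in> F"
    and sq: "F \<subseteq> eigenspace (M ** M) (x\<^sup>2)" and "x \<noteq> 0"
  shows "dim F = dim (F \<inter> eigenspace M x) + dim (F \<inter> eigenspace M (- x))"
proof -
  have "dim F = (\<Sum>y\<in>{x, - x}. dim (F \<inter> eigenspace M y))"
  proof (rule symmetric_invariant_dim_sum[OF assms(1-3)])
    fix v y assume v: "v \<in> F" "v \<noteq> 0" "M *v v = y *\<^sub>R v"
    then have "v \<in> eigenspace (M ** M) (y\<^sup>2)"
      by (intro eigenspace_mult_self) (simp add: eigenspace_def)
    with v sq have "y\<^sup>2 = x\<^sup>2" using eigenspace_unique by blast
    then show "y \<in> {x, - x}" by (simp add: power2_eq_iff)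
  qed auto
  with \<open>x \<noteq> 0\<close> show ?thesis by simp
qed

text \<open>The squared norm of \<open>A *v v\<close> is \<open>v \<bullet> (A *v (A *v v))\<close>.
  For \<open>lam = 0\<close> this replaces the eigenspace of the square by the kernel of
  \<open>A\<close>.\<close>

lemma kernel_mult_self_symmetric:
  fixes A :: "real^'n^'n"
  assumes "transpose A = A"
  shows "eigenspace (A ** A) 0 = eigenspace A 0"
proof -
  have "A *v v = 0" if "A *v (A *v v) = 0" for v
    using inner_symmetric_matrix[OF assms, of v "A *v v"] that by simp
  then show ?thesis
    by (auto simp: eigenspace_def simp flip: matrix_vector_mul_assoc)
qed

section \<open>The two products\<close>

text \<open>The bipartite structure is condensed into an involution \<open>D\<close> anticommuting
  with \<open>A\<close>; the size of the colour class returns at the end as the dimension of the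
  \<open>1\<close>-eigenspace of \<open>D\<close>.\<close>

locale anticommuting_involution =
  fixes A D :: "real^'a::finite^'a" and B :: "real^'b::finite^'b"
  assumes A: "transpose A = A" and D: "transpose D = D" and B: "transpose B = B"
    and DD: "D ** D = mat 1" and DA: "D ** A = - (A ** D)"
begin

definition cartesian :: "real^('a \<times> 'b)^('a \<times> 'b)" where
  "cartesian = kronecker A (mat 1) + kronecker D B"

definition semistrong :: "real^('a \<times> 'b)^('a \<times> 'b)" where
  "semistrong = kronecker (A + D) B"

abbreviation X :: "real^('a \<times> 'b)^('a \<times> 'b)" where
  "X \<equiv> kronecker (A ** A) (mat 1)"

abbreviation Y :: "real^('a \<times> 'b)^('a \<times> 'b)" where
  "Y \<equiv> kronecker (mat 1) (B ** B)"

abbreviation W :: "real \<Rightarrow> real \<Rightarrow> (real^('a \<times> 'b)) set" where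
  "W a b \<equiv> tensor_space (eigenspace (A ** A) a) (eigenspace (B ** B) b)"

lemmas W_eq = tensor_space_eigenspaces[of "A ** A" _ "B ** B"]

lemma DAA: "D ** (A ** A) = (A ** A) ** D"
  by (metis DA matrix_mul_assoc matrix_mult_minus_left matrix_mult_minus_right minus_minus)

lemma ADD: "(A ** D) ** D = A" by (simp add: DD flip: matrix_mul_assoc)

lemma AD_sq: "(A ** D) ** (A ** D) = - (A ** A)"
  by (metis ADD DA matrix_mul_assoc matrix_mult_minus_left matrix_mult_minus_right)

lemma transpose_cartesian: "transpose cartesian = cartesian"
  by (simp add: cartesian_def transpose_add transpose_kronecker A B D)

lemma transpose_semistrong: "transpose semistrong = semistrong"
  by (simp add: semistrong_def transpose_kronecker transpose_add A B D)

lemma transpose_X: "transpose X = X"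
  by (simp add: transpose_kronecker matrix_transpose_mul A)

lemma transpose_Y: "transpose Y = Y"
  by (simp add: transpose_kronecker matrix_transpose_mul B)

lemma cartesian_sq: "cartesian ** cartesian = X + Y"
proof -
  have "cartesian ** cartesian = X + kronecker (A ** D + D ** A) B + Y"
    by (simp add: cartesian_def matrix_add_ldistrib matrix_add_rdistrib kronecker_mult DD
        kronecker_add_left)
  also have "kronecker (A ** D + D ** A) B = 0"
    by (simp add: DA) (simp add: kronecker_def vec_eq_iff)
  finally show ?thesis by simp
qed

text \<open>\<open>Y ** X\<close> is the Kronecker product of the two squares, factored so that it
  visibly acts on \<open>W a b\<close> as \<open>a * b\<close>.\<close>

lemma semistrong_sq: "semistrong ** semistrong = Y ** X + Y"
proof -
  have "(A + D) ** (A + D) = A ** A + mat 1"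
    by (simp add: matrix_add_ldistrib matrix_add_rdistrib DD DA)
  then show ?thesis
    by (simp add: semistrong_def kronecker_mult) (simp add: kronecker_add_left)
qed

lemma cartesian_X: "cartesian ** X = X ** cartesian"
  by (simp add: cartesian_def matrix_add_ldistrib matrix_add_rdistrib kronecker_mult DAA)
    (simp add: matrix_mul_assoc)

lemma cartesian_Y: "cartesian ** Y = Y ** cartesian"
  by (simp add: cartesian_def matrix_add_ldistrib matrix_add_rdistrib kronecker_mult
      matrix_mul_assoc)

lemma semistrong_X: "semistrong ** X = X ** semistrong"
proof -
  have "(A + D) ** (A ** A) = (A ** A) ** (A + D)"
    unfolding matrix_add_ldistrib matrix_add_rdistrib DAA by (simp add: matrix_mul_assoc)
  then show ?thesis by (simp add: semistrong_def kronecker_mult)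
qed

lemma semistrong_Y: "semistrong ** Y = Y ** semistrong"
  by (simp add: semistrong_def kronecker_mult matrix_mul_assoc)

section \<open>Joint eigenspaces and the multiplicities they contribute\<close>

lemma mem_W_iff: "v \<in> W a b \<longleftrightarrow> X *v v = a *\<^sub>R v \<and> Y *v v = b *\<^sub>R v"
  unfolding W_eq by (simp add: eigenspace_def)

lemma subspace_W: "subspace (W a b)"
  by (simp add: W_eq subspace_inter subspace_eigenspace)

lemma dim_W: "dim (W a b) = eig_mult (A ** A) a * eig_mult (B ** B) b"
  by (simp add: dim_tensor_space subspace_eigenspace eig_mult_def)

lemma W_subset_cartesian_sq: "W a b \<subseteq> eigenspace (cartesian ** cartesian) (a + b)"
  unfolding cartesian_sq
  by (rule subsetI) (simp add: mem_W_iff eigenspace_def[of "_ + _"]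
      matrix_vector_mult_add_rdistrib scaleR_add_left)

lemma W_subset_semistrong_sq: "W a b \<subseteq> eigenspace (semistrong ** semistrong) ((a + 1) * b)"
  unfolding semistrong_sq
  by (rule subsetI) (simp add: mem_W_iff eigenspace_def[of "_ + _"]
      matrix_vector_mult_add_rdistrib algebra_simps matrix_vector_mult_scaleR
      flip: matrix_vector_mul_assoc)

lemma W_invariant:
  assumes "M ** X = X ** M" "M ** Y = Y ** M" "v \<in> W a b"
  shows "M *v v \<in> W a b"
  using assms eigenspace_commute unfolding W_eq by blast

text \<open>The eigenspace of \<open>M\<close> is invariant under \<open>X\<close>, and each piece
  that \<open>X\<close> cuts from it is invariant under \<open>Y\<close>. The counting lemma is
  applied to \<open>X\<close> and then to \<open>Y\<close>, not to \<open>M\<close>.\<close>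

lemma eig_mult_eq_sum:
  assumes "M ** X = X ** M" "M ** Y = Y ** M"
  shows "eig_mult M x = (\<Sum>a | eigenvalue (A ** A) a. \<Sum>b | eigenvalue (B ** B) b.
    eig_mult_from A B a b M x)"
proof -
  have fin: "finite {a. eigenvalue (A ** A) a}" "finite {b. eigenvalue (B ** B) b}"
    by (simp_all add: finite_eigenvalues_symmetric matrix_transpose_mul A B)
  have "eig_mult M x = (\<Sum>a | eigenvalue (A ** A) a. dim (eigenspace M x \<inter> eigenspace X a))"
    unfolding eig_mult_def
  proof (rule symmetric_invariant_dim_sum[OF transpose_X subspace_eigenspace _ fin(1)])
    show "X *v v \<in> eigenspace M x" if "v \<in> eigenspace M x" for v
      using eigenspace_commute[of X M] that assms(1) by simp
    show "a \<in> {a. eigenvalue (A ** A) a}" if "v \<noteq> 0" "X *v v = a *\<^sub>R v" for v a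
      using that eigenvalue_kronecker_left[where 'b='b, of "A ** A" a]
      by (auto simp: eigenvalue_def eigenspace_def)
  qed
  also have "\<dots> = (\<Sum>a | eigenvalue (A ** A) a. \<Sum>b | eigenvalue (B ** B) b.
      eig_mult_from A B a b M x)"
  proof (rule sum.cong[OF refl])
    fix a
    have "dim (eigenspace M x \<inter> eigenspace X a) =
        (\<Sum>b | eigenvalue (B ** B) b. dim ((eigenspace M x \<inter> eigenspace X a) \<inter> eigenspace Y b))"
    proof (rule symmetric_invariant_dim_sum[OF transpose_Y _ _ fin(2)])
      show "subspace (eigenspace M x \<inter> eigenspace X a)"
        by (intro subspace_inter subspace_eigenspace)
      have "Y ** X = X ** Y" by (simp add: kronecker_mult)
      then show "Y *v v \<in> eigenspace M x \<inter> eigenspace X a"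
        if "v \<in> eigenspace M x \<inter> eigenspace X a" for v
        using eigenspace_commute[of Y M] eigenspace_commute[of Y X] that assms(2) by auto
      show "b \<in> {b. eigenvalue (B ** B) b}" if "v \<noteq> 0" "Y *v v = b *\<^sub>R v" for v b
        using that eigenvalue_kronecker_right[where 'a='a, of "B ** B" b]
        by (auto simp: eigenvalue_def eigenspace_def)
    qed
    then show "dim (eigenspace M x \<inter> eigenspace X a) =
        (\<Sum>b | eigenvalue (B ** B) b. eig_mult_from A B a b M x)"
      by (simp add: eig_mult_from_def W_eq Int_ac)
  qed
  finally show ?thesis .
qed

lemma eig_mult_from_eq_0:
  assumes "W a b \<subseteq> eigenspace M y" "x \<noteq> y"
  shows "eig_mult_from A B a b M x = 0"
  unfolding eig_mult_from_def dim_eq_0 using assms eigenspace_unique by blast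

lemma eig_mult_from_sq_eq_0:
  assumes "W a b \<subseteq> eigenspace (M ** M) y" "x\<^sup>2 \<noteq> y"
  shows "eig_mult_from A B a b M x = 0"
  unfolding eig_mult_from_def dim_eq_0
  using assms eigenspace_unique eigenspace_mult_self by blast

lemma eig_mult_from_full:
  assumes "W a b \<subseteq> eigenspace M x"
  shows "eig_mult_from A B a b M x = eig_mult (A ** A) a * eig_mult (B ** B) b"
  using assms by (simp add: eig_mult_from_def Int_absorb2 dim_W)

text \<open>The bridge from the contribution of one pair to the total multiplicity: all other terms
  of the double sum vanish.\<close>

lemma eig_mult_eq_single:
  assumes "M ** X = X ** M" "M ** Y = Y ** M"
    and "eigenvalue (A ** A) a" "eigenvalue (B ** B) b"
    and zero: "\<And>a' b'. eigenvalue (A ** A) a' \<Longrightarrow> eigenvalue (B ** B) b' \<Longrightarrow>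
      (a', b') \<noteq> (a, b) \<Longrightarrow> eig_mult_from A B a' b' M x = 0"
  shows "eig_mult M x = eig_mult_from A B a b M x"
proof -
  let ?I = "{a. eigenvalue (A ** A) a} \<times> {b. eigenvalue (B ** B) b}"
  have fin: "finite ?I"
    by (simp add: finite_eigenvalues_symmetric matrix_transpose_mul A B)
  have "eig_mult M x = (\<Sum>(a', b')\<in>?I. eig_mult_from A B a' b' M x)"
    by (simp add: eig_mult_eq_sum[OF assms(1,2)] sum.cartesian_product)
  also have "\<dots> = (\<Sum>(a', b')\<in>{(a, b)}. eig_mult_from A B a' b' M x)"
  proof (rule sum.mono_neutral_right[OF fin])
    show "{(a, b)} \<subseteq> ?I" using assms(3,4) by simp
    show "\<forall>i\<in>?I - {(a, b)}. (case i of (a', b') \<Rightarrow> eig_mult_from A B a' b' M x) = 0"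
    proof
      fix i assume "i \<in> ?I - {(a, b)}"
      then show "(case i of (a', b') \<Rightarrow> eig_mult_from A B a' b' M x) = 0"
        using zero[of "fst i" "snd i"] by (cases i) auto
    qed
  qed
  finally show ?thesis by simp
qed

lemma eig_mult_from_le: "eig_mult_from A B a b M x \<le> eig_mult M x"
  unfolding eig_mult_from_def eig_mult_def by (intro dim_subset) auto

text \<open>\<open>?T\<close> preserves \<open>W a b\<close> because it commutes with
  \<open>X\<close> and \<open>Y\<close>, and is injective there because
  \<open>?T ** ?T = - X\<close> is the nonzero scalar \<open>- a\<close>. So the parts of
  \<open>W a b\<close> for \<open>x\<close> and \<open>- x\<close> are equally large, and together
  they exhaust its dimension.\<close>

lemma eig_mult_from_anticommute:
  assumes M: "transpose M = M" "M ** X = X ** M" "M ** Y = Y ** M"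
    and sq: "W a b \<subseteq> eigenspace (M ** M) (x\<^sup>2)" and "x \<noteq> 0" "a \<noteq> 0"
    and anti: "kronecker (A ** D) (mat 1) ** M = - (M ** kronecker (A ** D) (mat 1))"
  shows "2 * eig_mult_from A B a b M x = eig_mult (A ** A) a * eig_mult (B ** B) b"
proof -
  let ?T = "kronecker (A ** D) (mat 1) :: real^('a \<times> 'b)^('a \<times> 'b)"
  have T: "?T ** X = X ** ?T" "?T ** Y = Y ** ?T" "?T ** ?T = - X"
    using DAA by (simp_all add: kronecker_mult AD_sq kronecker_minus_left)
      (metis matrix_mul_assoc)
  have "v = 0" if v: "v \<in> W a b" "?T *v v = 0" for v
  proof -
    have "- (X *v v) = ?T *v (?T *v v)"
      by (simp add: matrix_vector_mul_assoc T(3) matrix_vector_mult_uminus_left)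
    with v \<open>a \<noteq> 0\<close> show ?thesis by (simp add: mem_W_iff)
  qed
  then have "dim (W a b \<inter> eigenspace M (- x)) = dim (W a b \<inter> eigenspace M x)"
    using W_invariant[OF T(1,2)] by (intro dim_eigenspace_anticommute[OF anti subspace_W])
  moreover have "dim (W a b) = dim (W a b \<inter> eigenspace M x) + dim (W a b \<inter> eigenspace M (- x))"
    using M sq \<open>x \<noteq> 0\<close> W_invariant by (intro dim_square_split subspace_W) auto
  ultimately show ?thesis by (simp add: eig_mult_from_def dim_W)
qed

lemma cartesian_anticommute:
  "kronecker (A ** D) (mat 1) ** cartesian = - (cartesian ** kronecker (A ** D) (mat 1))"
proof -
  have "(A ** D) ** A = - (A ** (A ** D))"
    by (metis DA matrix_mul_assoc matrix_mult_minus_right)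
  moreover have "D ** (A ** D) = - A"
    by (metis ADD DA matrix_mul_assoc matrix_mult_minus_left)
  ultimately show ?thesis
    by (simp add: cartesian_def matrix_add_ldistrib matrix_add_rdistrib kronecker_mult ADD
        kronecker_minus_left)
qed

lemma semistrong_anticommute:
  "kronecker (A ** D) (mat 1) ** semistrong = - (semistrong ** kronecker (A ** D) (mat 1))"
proof -
  have "(A ** D) ** A = - (A ** (A ** D))"
    by (metis DA matrix_mul_assoc matrix_mult_minus_right)
  moreover have "D ** (A ** D) = - A"
    by (metis ADD DA matrix_mul_assoc matrix_mult_minus_left)
  ultimately show ?thesis
    by (simp add: semistrong_def matrix_add_ldistrib matrix_add_rdistrib kronecker_mult ADD
        kronecker_minus_left kronecker_add_left)
qed

section \<open>The kernel of \<open>A\<close> and the signature of \<open>D\<close>\<close>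

lemma W_kernel_eq:
  "W 0 b = eigenspace (kronecker A (mat 1)) 0 \<inter> eigenspace Y b"
  by (simp add: kernel_mult_self_symmetric[OF A] tensor_space_eigenspaces)

lemma cartesian_on_kernel:
  assumes "v \<in> W 0 b"
  shows "cartesian *v v = kronecker D B *v v"
  using assms unfolding W_kernel_eq cartesian_def
  by (simp add: eigenspace_def matrix_vector_mult_add_rdistrib)

lemma semistrong_on_kernel:
  assumes "v \<in> W 0 b"
  shows "semistrong *v v = kronecker D B *v v"
proof -
  \<comment> \<open>Splitting off the factor that acts first shows that the \<open>A\<close> part of
    the semi-strong product vanishes here.\<close>
  have "kronecker A B = kronecker (mat 1) B ** kronecker A (mat 1)"
    by (simp add: kronecker_mult)
  then have "kronecker A B *v v = kronecker (mat 1) B *v (kronecker A (mat 1) *v v)"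
    by (simp add: matrix_vector_mul_assoc)
  with assms show ?thesis unfolding W_kernel_eq semistrong_def
    by (simp add: eigenspace_def kronecker_add_left matrix_vector_mult_add_rdistrib)
qed

text \<open>Where \<open>kronecker D (mat 1)\<close> is the scalar \<open>e\<close>,
  \<open>kronecker D B\<close> is \<open>e\<close> times \<open>kronecker (mat 1) B\<close>. Since
  \<open>e\<close> is its own inverse, the eigenvalue \<open>x\<close> of the product corresponds to
  \<open>e * x\<close> for \<open>B\<close>.\<close>

lemma eigenspaces_inter_tensor_space:
  assumes "e = 1 \<or> e = -1"
  shows "(W 0 (x\<^sup>2) \<inter> eigenspace (kronecker D B) x) \<inter> eigenspace (kronecker D (mat 1)) e =
    tensor_space (eigenspace A 0 \<inter> eigenspace D e) (eigenspace B (e * x))"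
proof (rule set_eqI)
  fix v :: "real^('a \<times> 'b)"
  let ?B = "kronecker (mat 1) B :: real^('a \<times> 'b)^('a \<times> 'b)"
  let ?D = "kronecker D (mat 1) :: real^('a \<times> 'b)^('a \<times> 'b)"
  have "kronecker D B = ?B ** ?D" by (simp add: kronecker_mult)
  then have "kronecker D B *v v = ?B *v (?D *v v)" by (simp add: matrix_vector_mul_assoc)
  then have 1: "v \<in> eigenspace (kronecker D B) x \<longleftrightarrow> v \<in> eigenspace ?B (e * x)"
    if "v \<in> eigenspace ?D e"
    using that assms by (auto simp: eigenspace_def matrix_vector_mult_scaleR)
      (metis minus_minus)
  have "(e * x)\<^sup>2 = x\<^sup>2" using assms by auto
  then have 2: "v \<in> eigenspace Y (x\<^sup>2)" if "v \<in> eigenspace ?B (e * x)"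
    using eigenspace_mult_self[OF that] by (simp add: kronecker_mult)
  have "v \<in> tensor_space (eigenspace A 0 \<inter> eigenspace D e) (eigenspace B (e * x)) \<longleftrightarrow>
      v \<in> eigenspace (kronecker A (mat 1)) 0 \<and> v \<in> eigenspace ?D e \<and> v \<in> eigenspace ?B (e * x)"
    by (auto simp: tensor_space_eq_slices subspace_inter subspace_eigenspace
        eigenspace_kronecker_left eigenspace_kronecker_right)
  with 1 2 show "v \<in> (W 0 (x\<^sup>2) \<inter> eigenspace (kronecker D B) x) \<inter> eigenspace ?D e \<longleftrightarrow>
      v \<in> tensor_space (eigenspace A 0 \<inter> eigenspace D e) (eigenspace B (e * x))"
    unfolding W_kernel_eq by blast
qed

text \<open>\<open>kronecker D (mat 1)\<close> commutes with \<open>kronecker D B\<close> and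
  squares to the identity, so it cuts the contribution into two tensor products, one for each sign
  of \<open>D\<close>.\<close>

lemma eig_mult_from_kernel:
  assumes "\<And>v. v \<in> W 0 (x\<^sup>2) \<Longrightarrow> M *v v = kronecker D B *v v"
  shows "eig_mult_from A B 0 (x\<^sup>2) M x =
    dim (eigenspace A 0 \<inter> eigenspace D 1) * eig_mult B x +
    dim (eigenspace A 0 \<inter> eigenspace D (- 1)) * eig_mult B (- x)"
proof -
  let ?N = "kronecker D B"
  let ?D = "kronecker D (mat 1) :: real^('a \<times> 'b)^('a \<times> 'b)"
  let ?F = "W 0 (x\<^sup>2) \<inter> eigenspace ?N x"
  have comm: "?D ** X = X ** ?D" "?D ** Y = Y ** ?D" "?D ** ?N = ?N ** ?D"
    by (simp_all add: kronecker_mult DAA DD)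
  have sq: "?D ** ?D = mat 1" by (simp add: kronecker_mult DD kronecker_mat_1)
  have "W 0 (x\<^sup>2) \<inter> eigenspace M x = ?F"
    using assms by (auto simp: eigenspace_def[of M] eigenspace_def[of ?N])
  then have "eig_mult_from A B 0 (x\<^sup>2) M x = dim ?F"
    by (simp add: eig_mult_from_def)
  also have "\<dots> = (\<Sum>e\<in>{1, - 1}. dim (?F \<inter> eigenspace ?D e))"
  proof (rule symmetric_invariant_dim_sum)
    show "transpose ?D = ?D" by (simp add: transpose_kronecker D)
    show "subspace ?F" by (intro subspace_inter subspace_W subspace_eigenspace)
    show "?D *v v \<in> ?F" if "v \<in> ?F" for v
      using that W_invariant[OF comm(1,2)] eigenspace_commute[OF comm(3)] by blast
    show "e \<in> {1, - 1}" if "v \<noteq> 0" "?D *v v = e *\<^sub>R v" for v e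
    proof -
      have "v \<in> eigenspace (?D ** ?D) (e\<^sup>2)"
        using that(2) by (intro eigenspace_mult_self) (simp add: eigenspace_def)
      moreover have "v \<in> eigenspace (?D ** ?D) 1"
        unfolding sq by (simp add: eigenspace_def)
      ultimately have "e\<^sup>2 = 1" using that(1) eigenspace_unique by blast
      then show ?thesis by (simp add: power2_eq_1_iff)
    qed
  qed simp
  also have "\<dots> = dim (?F \<inter> eigenspace ?D 1) + dim (?F \<inter> eigenspace ?D (- 1))"
    by simp
  finally show ?thesis
    by (simp add: eigenspaces_inter_tensor_space dim_tensor_space subspace_inter
        subspace_eigenspace eig_mult_def)
qed

lemma dim_kernel_split:
  "eig_mult (A ** A) 0 =
    dim (eigenspace A 0 \<inter> eigenspace D 1) + dim (eigenspace A 0 \<inter> eigenspace D (- 1))"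
proof -
  have "D *v v \<in> eigenspace A 0" if "v \<in> eigenspace A 0" for v
    using eigenspace_anticommute[of D A v 0] DA that by simp
  then show ?thesis
    unfolding eig_mult_def kernel_mult_self_symmetric[OF A]
    using DD by (intro dim_square_split D subspace_eigenspace) (auto simp: eigenspace_def)
qed

text \<open>On the eigenspaces of \<open>A\<^sup>2\<close> for nonzero eigenvalues, \<open>A\<close> is invertible and exchanges the
  \<open>\<plusminus>1\<close>-eigenspaces of \<open>D\<close>, so only the kernel contributes to the signature of \<open>D\<close>.\<close>

lemma dim_kernel_signature:
  "dim (eigenspace A 0 \<inter> eigenspace D 1) + dim (eigenspace D (- 1)) =
    dim (eigenspace A 0 \<inter> eigenspace D (- 1)) + dim (eigenspace D 1)"
proof -
  \<comment> \<open>Inserting \<open>0\<close> lets the kernel term be split off even when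
    \<open>A\<close> is invertible; it then has dimension 0.\<close>
  let ?L = "insert 0 {a. eigenvalue (A ** A) a}"
  let ?d = "\<lambda>e a. dim (eigenspace (A ** A) a \<inter> eigenspace D e)"
  have sym: "transpose (A ** A) = A ** A" by (simp add: matrix_transpose_mul A)
  have fin: "finite ?L" using finite_eigenvalues_symmetric[OF sym] by simp
  have sum: "dim (eigenspace D e) = ?d e 0 + (\<Sum>a\<in>?L - {0}. ?d e a)" for e
  proof -
    have "dim (eigenspace D e) = (\<Sum>a\<in>?L. dim (eigenspace D e \<inter> eigenspace (A ** A) a))"
    proof (rule symmetric_invariant_dim_sum[OF sym subspace_eigenspace _ fin])
      show "(A ** A) *v v \<in> eigenspace D e" if "v \<in> eigenspace D e" for v
        using DAA that by (intro eigenspace_commute) simp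
    qed (auto simp: eigenvalue_def eigenspace_def)
    also have "\<dots> = (\<Sum>a\<in>?L. ?d e a)" by (simp add: Int_commute)
    also have "\<dots> = ?d e 0 + (\<Sum>a\<in>?L - {0}. ?d e a)"
      using fin by (intro sum.remove) auto
    finally show ?thesis .
  qed
  have "?d (- 1) a = ?d 1 a" if "a \<noteq> 0" for a
  proof (rule dim_eigenspace_anticommute[OF _ subspace_eigenspace])
    show "A ** D = - (D ** A)" by (simp add: DA)
    show "A *v v \<in> eigenspace (A ** A) a" if "v \<in> eigenspace (A ** A) a" for v
      using that by (intro eigenspace_commute) (simp_all add: matrix_mul_assoc)
    show "v = 0" if "v \<in> eigenspace (A ** A) a" "A *v v = 0" for v
      using that \<open>a \<noteq> 0\<close> by (simp add: eigenspace_def flip: matrix_vector_mul_assoc)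
  qed
  then have "(\<Sum>a\<in>?L - {0}. ?d (- 1) a) = (\<Sum>a\<in>?L - {0}. ?d 1 a)"
    by (intro sum.cong) auto
  with sum[of 1] sum[of "- 1"] show ?thesis
    by (simp add: kernel_mult_self_symmetric[OF A])
qed

text \<open>At \<open>x = mu\<close> this gives \<open>- mu\<close> the multiplicity
  \<open>q - t\<close>, so \<open>q - 2 * t\<close> is the excess of \<open>- mu\<close> over
  \<open>mu\<close> in \<open>B\<close>.\<close>

lemma eig_mult_square:
  assumes "x \<noteq> 0"
  shows "eig_mult (B ** B) (x\<^sup>2) = eig_mult B x + eig_mult B (- x)"
proof -
  have "eigenspace B y \<subseteq> eigenspace (B ** B) (x\<^sup>2)" if "y = x \<or> y = - x" for y
    using eigenspace_mult_self[of _ B y] that by auto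
  then show "eig_mult (B ** B) (x\<^sup>2) = eig_mult B x + eig_mult B (- x)"
    using dim_square_split[OF B subspace_eigenspace, of "B ** B" "x\<^sup>2" x] \<open>x \<noteq> 0\<close>
      eigenspace_commute[of B "B ** B"]
    by (simp add: eig_mult_def matrix_mul_assoc Int_absorb1)
qed

text \<open>In the notation of the theorem the count is \<open>k * t + k' * (q - t)\<close>, where
  \<open>k\<close> and \<open>k'\<close> are the dimensions of the two sign parts of the kernel of
  \<open>A\<close>. Here \<open>k + k' = p\<close>, and the signature lemma gives
  \<open>k - k' = 2 * d - n\<close> with \<open>d\<close> the dimension of the
  \<open>1\<close>-eigenspace of \<open>D\<close>; solving for \<open>k\<close> and
  \<open>k'\<close> produces both halves of the formula.\<close>

lemma eig_mult_from_kernel_formula: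
  assumes "\<And>v. v \<in> W 0 (x\<^sup>2) \<Longrightarrow> M *v v = kronecker D B *v v" and "x \<noteq> 0"
  shows "real (eig_mult_from A B 0 (x\<^sup>2) M x) =
    1/2 * (real (eig_mult (A ** A) 0) * real (eig_mult (B ** B) (x\<^sup>2))) +
    1/2 * (real CARD('a) - 2 * real (dim (eigenspace D 1))) *
      (real (eig_mult (B ** B) (x\<^sup>2)) - 2 * real (eig_mult B x))"
proof -
  have "dim (UNIV :: (real^'a) set) = dim (UNIV \<inter> eigenspace D 1) + dim (UNIV \<inter> eigenspace D (- 1))"
    using DD by (intro dim_square_split D) (auto simp: eigenspace_def)
  then have n: "CARD('a) = dim (eigenspace D 1) + dim (eigenspace D (- 1))"
    by simp
  note q = eig_mult_square[OF \<open>x \<noteq> 0\<close>]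
  define k k' d d' where "k = real (dim (eigenspace A 0 \<inter> eigenspace D 1))"
    and "k' = real (dim (eigenspace A 0 \<inter> eigenspace D (- 1)))"
    and "d = real (dim (eigenspace D 1))" and "d' = real (dim (eigenspace D (- 1)))"
  have d': "d' = d + k' - k"
    using dim_kernel_signature unfolding k_def k'_def d_def d'_def by linarith
  have f: "eig_mult_from A B 0 (x\<^sup>2) M x =
    dim (eigenspace A 0 \<inter> eigenspace D 1) * eig_mult B x +
    dim (eigenspace A 0 \<inter> eigenspace D (- 1)) * eig_mult B (- x)"
    using assms(1) by (rule eig_mult_from_kernel)
  show ?thesis
    unfolding f dim_kernel_split q n of_nat_add of_nat_mult
      k_def[symmetric] k'_def[symmetric] d_def[symmetric] d'_def[symmetric] d'
    by (simp add: field_simps)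
qed

end

section \<open>From signed graphs to matrices\<close>

lemma transpose_adj_matrix: "transpose (adj_matrix \<Gamma>) = adj_matrix \<Gamma>"
  unfolding transpose_def vec_eq_iff by (simp add: adj_matrix_sym[of \<Gamma>])

lemma part_matrix_mult_left:
  "(part_matrix V ** M) $ u $ v = (if u \<in> V then M $ u $ v else - (M $ u $ v))"
  by (simp add: part_matrix_def matrix_matrix_mult_def mult_delta_left)

lemma part_matrix_mult_right:
  "(M ** part_matrix V) $ u $ v = (if v \<in> V then M $ u $ v else - (M $ u $ v))"
  by (simp add: part_matrix_def matrix_matrix_mult_def mult_delta_right)

text \<open>Multiplying by the partition matrix changes signs of rows or of columns. An entry of the
  adjacency matrix is nonzero only between the two classes, where exactly one of the two operations
  changes its sign.\<close>

lemma part_matrix_anticommuting_involution: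
  assumes "bipartition \<Gamma>\<^sub>1 V\<^sub>1 V\<^sub>2"
  shows "anticommuting_involution (adj_matrix \<Gamma>\<^sub>1) (part_matrix V\<^sub>1) (adj_matrix \<Gamma>\<^sub>2)"
proof
  show "transpose (part_matrix V\<^sub>1) = part_matrix V\<^sub>1"
    by (simp add: part_matrix_def transpose_def vec_eq_iff)
  show "part_matrix V\<^sub>1 ** part_matrix V\<^sub>1 = mat 1"
    unfolding vec_eq_iff part_matrix_mult_left by (simp add: part_matrix_def mat_def)
  have "u \<in> V\<^sub>1 \<longleftrightarrow> v \<notin> V\<^sub>1" if "adj_matrix \<Gamma>\<^sub>1 $ u $ v \<noteq> 0" for u v
  proof -
    have "{u, v} \<in> fst \<Gamma>\<^sub>1" using that by (auto simp: adj_matrix_def split: if_splits)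
    then obtain a b where "a \<in> V\<^sub>1" "b \<in> V\<^sub>2" "{u, v} = {a, b}"
      using assms unfolding bipartition_def by metis
    moreover have "b \<notin> V\<^sub>1" using assms \<open>b \<in> V\<^sub>2\<close> by (auto simp: bipartition_def)
    ultimately show ?thesis by (auto simp: doubleton_eq_iff)
  qed
  then show "part_matrix V\<^sub>1 ** adj_matrix \<Gamma>\<^sub>1 = - (adj_matrix \<Gamma>\<^sub>1 ** part_matrix V\<^sub>1)"
    unfolding vec_eq_iff part_matrix_mult_left
    by (auto simp: part_matrix_mult_right)
qed (simp_all add: transpose_adj_matrix)

lemma dim_eigenspace_part_matrix: "dim (eigenspace (part_matrix V) 1) = card V"
proof -
  have "eigenspace (part_matrix V) 1 = {x. \<forall>i. i \<notin> V \<longrightarrow> x $ i = 0}"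
    by (auto simp: eigenspace_def part_matrix_def matrix_vector_mult_def vec_eq_iff
        mult_delta_left split: if_splits)
  then show ?thesis
    using dim_substandard_cart[where 'a=real, of V] by (simp add: dim_vec_eq)
qed

theorem theorem4p1:
  fixes \<Gamma>\<^sub>1 :: "'a::finite signed_graph" and \<Gamma>\<^sub>2 :: "'b::finite signed_graph"
    and V\<^sub>1 V\<^sub>2 :: "'a set" and lam mu :: real and n m p q t :: nat
    and A\<^sub>1 :: "real^'a^'a" and A\<^sub>2 :: "real^'b^'b" and C S :: "real^('a \<times> 'b)^('a \<times> 'b)"
  assumes "signed_graph \<Gamma>\<^sub>1" and "signed_graph \<Gamma>\<^sub>2" and "bipartition \<Gamma>\<^sub>1 V\<^sub>1 V\<^sub>2"
    and "n = CARD('a)" and "m = CARD('b)"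
    and "A\<^sub>1 = adj_matrix \<Gamma>\<^sub>1" and "A\<^sub>2 = adj_matrix \<Gamma>\<^sub>2"
    and "C = adj_matrix (signed_cartesian \<Gamma>\<^sub>1 V\<^sub>1 \<Gamma>\<^sub>2)"
    and "S = adj_matrix (signed_semistrong \<Gamma>\<^sub>1 V\<^sub>1 \<Gamma>\<^sub>2)"
    and "eigenvalue (A\<^sub>1 ** A\<^sub>1) (lam\<^sup>2)" and "p = eig_mult (A\<^sub>1 ** A\<^sub>1) (lam\<^sup>2)"
    and "eigenvalue (A\<^sub>2 ** A\<^sub>2) (mu\<^sup>2)" and "q = eig_mult (A\<^sub>2 ** A\<^sub>2) (mu\<^sup>2)"
    and "t = eig_mult A\<^sub>2 mu"
  shows
    \<comment> \<open>(i)-(iv), each multiplicity being the one contributed by the given pair of eigenvalues\<close>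
    "(eigenvalue (C ** C) (lam\<^sup>2 + mu\<^sup>2) \<and>
      eig_mult_from A\<^sub>1 A\<^sub>2 (lam\<^sup>2) (mu\<^sup>2) (C ** C) (lam\<^sup>2 + mu\<^sup>2) = p * q \<and>
      eigenvalue (S ** S) ((lam\<^sup>2 + 1) * mu\<^sup>2) \<and>
      eig_mult_from A\<^sub>1 A\<^sub>2 (lam\<^sup>2) (mu\<^sup>2) (S ** S) ((lam\<^sup>2 + 1) * mu\<^sup>2) = p * q)
     \<and>
     (lam = 0 \<and> mu \<noteq> 0 \<longrightarrow>
      (\<forall>M \<in> {C, S}.
        real (eig_mult_from A\<^sub>1 A\<^sub>2 (lam\<^sup>2) (mu\<^sup>2) M mu) =
          1/2 * (real p * real q) + 1/2 * (real n - 2 * real (card V\<^sub>1)) * (real q - 2 * real t) \<and>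
        real (eig_mult_from A\<^sub>1 A\<^sub>2 (lam\<^sup>2) (mu\<^sup>2) M (- mu)) =
          1/2 * (real p * real q) - 1/2 * (real n - 2 * real (card V\<^sub>1)) * (real q - 2 * real t)))
     \<and>
     (lam \<noteq> 0 \<longrightarrow>
      (\<forall>\<nu> \<in> {sqrt (lam\<^sup>2 + mu\<^sup>2), - sqrt (lam\<^sup>2 + mu\<^sup>2)}.
        eigenvalue C \<nu> \<and>
        real (eig_mult_from A\<^sub>1 A\<^sub>2 (lam\<^sup>2) (mu\<^sup>2) C \<nu>) = real p * real q / 2))
     \<and>
     (lam * mu \<noteq> 0 \<longrightarrow>
      (\<forall>\<nu> \<in> {sqrt ((lam\<^sup>2 + 1) * mu\<^sup>2), - sqrt ((lam\<^sup>2 + 1) * mu\<^sup>2)}.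
        eigenvalue S \<nu> \<and>
        real (eig_mult_from A\<^sub>1 A\<^sub>2 (lam\<^sup>2) (mu\<^sup>2) S \<nu>) = real p * real q / 2))
     \<and>
     \<comment> \<open>every total multiplicity is the sum of the contributions of all pairs of eigenvalues\<close>
     (\<forall>M \<in> {C, S, C ** C, S ** S}. \<forall>x.
        eig_mult M x =
          (\<Sum>a | eigenvalue (A\<^sub>1 ** A\<^sub>1) a. \<Sum>b | eigenvalue (A\<^sub>2 ** A\<^sub>2) b. eig_mult_from A\<^sub>1 A\<^sub>2 a b M x))
     \<and>
     \<comment> \<open>hence (i)-(iv) for the total multiplicities if no other pair yields the same value\<close>
     ((\<forall>a b. eigenvalue (A\<^sub>1 ** A\<^sub>1) a \<and> eigenvalue (A\<^sub>2 ** A\<^sub>2) b \<and> a + b = lam\<^sup>2 + mu\<^sup>2 \<longrightarrow>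
          a = lam\<^sup>2 \<and> b = mu\<^sup>2) \<longrightarrow>
      eig_mult (C ** C) (lam\<^sup>2 + mu\<^sup>2) = p * q \<and>
      (lam = 0 \<and> mu \<noteq> 0 \<longrightarrow>
        real (eig_mult C mu) =
          1/2 * (real p * real q) + 1/2 * (real n - 2 * real (card V\<^sub>1)) * (real q - 2 * real t) \<and>
        real (eig_mult C (- mu)) =
          1/2 * (real p * real q) - 1/2 * (real n - 2 * real (card V\<^sub>1)) * (real q - 2 * real t)) \<and>
      (lam \<noteq> 0 \<longrightarrow>
        real (eig_mult C (sqrt (lam\<^sup>2 + mu\<^sup>2))) = real p * real q / 2 \<and>
        real (eig_mult C (- sqrt (lam\<^sup>2 + mu\<^sup>2))) = real p * real q / 2))
     \<and>
     ((\<forall>a b. eigenvalue (A\<^sub>1 ** A\<^sub>1) a \<and> eigenvalue (A\<^sub>2 ** A\<^sub>2) b \<and> (a + 1) * b = (lam\<^sup>2 + 1) * mu\<^sup>2 \<longrightarrow>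
          a = lam\<^sup>2 \<and> b = mu\<^sup>2) \<longrightarrow>
      eig_mult (S ** S) ((lam\<^sup>2 + 1) * mu\<^sup>2) = p * q \<and>
      (lam = 0 \<and> mu \<noteq> 0 \<longrightarrow>
        real (eig_mult S mu) =
          1/2 * (real p * real q) + 1/2 * (real n - 2 * real (card V\<^sub>1)) * (real q - 2 * real t) \<and>
        real (eig_mult S (- mu)) =
          1/2 * (real p * real q) - 1/2 * (real n - 2 * real (card V\<^sub>1)) * (real q - 2 * real t)) \<and>
      (lam * mu \<noteq> 0 \<longrightarrow>
        real (eig_mult S (sqrt ((lam\<^sup>2 + 1) * mu\<^sup>2))) = real p * real q / 2 \<and>
        real (eig_mult S (- sqrt ((lam\<^sup>2 + 1) * mu\<^sup>2))) = real p * real q / 2))"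
proof -
  interpret anticommuting_involution A\<^sub>1 "part_matrix V\<^sub>1" A\<^sub>2
    unfolding assms(6,7) by (rule part_matrix_anticommuting_involution[OF assms(3)])
  have C: "C = cartesian"
    unfolding assms(8) cartesian_def unfolding assms(6,7) by (rule adj_matrix_signed_cartesian(2)[OF assms(1,2)])
  have S: "S = semistrong"
    unfolding assms(9) semistrong_def unfolding assms(6,7) by (rule adj_matrix_signed_semistrong(2)[OF assms(1,2)])
  let ?f = "eig_mult_from A\<^sub>1 A\<^sub>2 (lam\<^sup>2) (mu\<^sup>2)"
  let ?plus = "1/2 * (real p * real q) + 1/2 * (real n - 2 * real (card V\<^sub>1)) * (real q - 2 * real t)"
  let ?minus = "1/2 * (real p * real q) - 1/2 * (real n - 2 * real (card V\<^sub>1)) * (real q - 2 * real t)"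
  have pq: "p * q > 0"
    using assms(10-13) by (simp add: eigenvalue_iff_eig_mult)
  \<comment> \<open>The contribution of a pair is a lower bound for the total multiplicity; with
    \<open>p * q > 0\<close> this supplies the existence claims.\<close>
  have evI: "eigenvalue M x" if "?f M x > 0" for M x
    using that eig_mult_from_le[of "lam\<^sup>2" "mu\<^sup>2" M x] by (simp add: eigenvalue_iff_eig_mult)
  have comm: "M ** X = X ** M \<and> M ** Y = Y ** M" if "M \<in> {C, S, C ** C, S ** S}" for M
  proof -
    have "(N ** N) ** Z = Z ** (N ** N)" if "N ** Z = Z ** N"
      for N Z :: "real^('a \<times> 'b)^('a \<times> 'b)"
      using that by (metis matrix_mul_assoc)
    with that show ?thesis
      unfolding C S using cartesian_X cartesian_Y semistrong_X semistrong_Y by blast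
  qed

  have sq_C: "?f (C ** C) (lam\<^sup>2 + mu\<^sup>2) = p * q"
    unfolding C assms(11,13) by (rule eig_mult_from_full[OF W_subset_cartesian_sq])
  have sq_S: "?f (S ** S) ((lam\<^sup>2 + 1) * mu\<^sup>2) = p * q"
    unfolding S assms(11,13) by (rule eig_mult_from_full[OF W_subset_semistrong_sq])
  have kernel: "real (?f M mu) = ?plus \<and>
      real (?f M (- mu)) = ?minus"
    if "M \<in> {C, S}" "lam = 0" "mu \<noteq> 0" for M
  proof -
    have M: "M *v v = kronecker (part_matrix V\<^sub>1) A\<^sub>2 *v v" if "v \<in> W 0 (mu\<^sup>2)" for v
      using \<open>M \<in> {C, S}\<close> that cartesian_on_kernel semistrong_on_kernel by (auto simp: C S)
    \<comment> \<open>The claim for \<open>- mu\<close> is the same formula taken at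
      \<open>- mu\<close>: \<open>t\<close> becomes \<open>q - t\<close>, which reverses the sign of
      \<open>q - 2 * t\<close>. The bound \<open>t \<le> q\<close> makes the natural subtraction
      exact.\<close>
    have q: "eig_mult A\<^sub>2 (- mu) = q - t" "t \<le> q"
      using eig_mult_square[OF \<open>mu \<noteq> 0\<close>] by (simp_all add: assms(13,14))
    show ?thesis
      using eig_mult_from_kernel_formula[of mu M, OF M] eig_mult_from_kernel_formula[of "- mu" M] M
        \<open>mu \<noteq> 0\<close> q
      by (simp add: \<open>lam = 0\<close> assms(4,11,13) assms(14)[symmetric] dim_eigenspace_part_matrix
          of_nat_diff algebra_simps)
  qed
  have sqrt_C: "\<nu>\<^sup>2 = lam\<^sup>2 + mu\<^sup>2" if "\<nu> \<in> {sqrt (lam\<^sup>2 + mu\<^sup>2), - sqrt (lam\<^sup>2 + mu\<^sup>2)}" for \<nu>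
    using that by auto
  have sqrt_S: "\<nu>\<^sup>2 = (lam\<^sup>2 + 1) * mu\<^sup>2"
    if "\<nu> \<in> {sqrt ((lam\<^sup>2 + 1) * mu\<^sup>2), - sqrt ((lam\<^sup>2 + 1) * mu\<^sup>2)}" for \<nu>
  proof -
    have "(lam\<^sup>2 + 1) * mu\<^sup>2 \<ge> 0" by simp
    with that show ?thesis by (auto simp del: real_sqrt_mult)
  qed
  have nz_C: "real (?f C \<nu>) = real p * real q / 2 \<and> eigenvalue C \<nu>"
    if "lam \<noteq> 0" "\<nu> \<in> {sqrt (lam\<^sup>2 + mu\<^sup>2), - sqrt (lam\<^sup>2 + mu\<^sup>2)}" for \<nu>
  proof -
    note \<nu> = sqrt_C[OF that(2)]
    \<comment> \<open>Strict positivity keeps \<open>\<nu>\<close> and \<open>- \<nu>\<close>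
      distinct, as the halving argument requires.\<close>
    have "lam\<^sup>2 + mu\<^sup>2 > 0" using that(1) by (simp add: add_pos_nonneg)
    with \<nu> have "\<nu> \<noteq> 0" by auto
    with \<nu> that(1) have "2 * ?f C \<nu> = p * q"
      unfolding C assms(11,13)
      by (intro eig_mult_from_anticommute transpose_cartesian cartesian_X cartesian_Y
          cartesian_anticommute) (use W_subset_cartesian_sq in auto)
    then have "2 * real (?f C \<nu>) = real p * real q"
      by (metis of_nat_mult of_nat_numeral)
    moreover have "?f C \<nu> > 0" using \<open>2 * ?f C \<nu> = p * q\<close> pq by linarith
    ultimately show ?thesis by (simp add: evI)
  qed
  have nz_S: "real (?f S \<nu>) = real p * real q / 2 \<and> eigenvalue S \<nu>"
    if "lam * mu \<noteq> 0" "\<nu> \<in> {sqrt ((lam\<^sup>2 + 1) * mu\<^sup>2), - sqrt ((lam\<^sup>2 + 1) * mu\<^sup>2)}" for \<nu>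
  proof -
    note \<nu> = sqrt_S[OF that(2)]
    \<comment> \<open>Here positivity depends on \<open>mu \<noteq> 0\<close>, while
      \<open>lam \<noteq> 0\<close> serves the invertibility of the sign-reversing map.\<close>
    have "(lam\<^sup>2 + 1) * mu\<^sup>2 > 0" using that(1) by (simp add: add_nonneg_pos)
    with \<nu> have "\<nu> \<noteq> 0" by auto
    with \<nu> that(1) have "2 * ?f S \<nu> = p * q"
      unfolding S assms(11,13)
      by (intro eig_mult_from_anticommute transpose_semistrong semistrong_X semistrong_Y
          semistrong_anticommute) (use W_subset_semistrong_sq in auto)
    then have "2 * real (?f S \<nu>) = real p * real q"
      by (metis of_nat_mult of_nat_numeral)
    moreover have "?f S \<nu> > 0" using \<open>2 * ?f S \<nu> = p * q\<close> pq by linarith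
    ultimately show ?thesis by (simp add: evI)
  qed
  have total: "\<forall>M\<in>{C, S, C ** C, S ** S}. \<forall>x. eig_mult M x =
      (\<Sum>a | eigenvalue (A\<^sub>1 ** A\<^sub>1) a. \<Sum>b | eigenvalue (A\<^sub>2 ** A\<^sub>2) b. eig_mult_from A\<^sub>1 A\<^sub>2 a b M x)"
    using comm by (intro ballI allI eig_mult_eq_sum) blast+

  \<comment> \<open>\<open>g\<close> stands for \<open>a + b\<close> or \<open>(a + 1) * b\<close>,
    the scalar by which \<open>M ** M\<close> acts on \<open>W a b\<close>. Under
    \<open>uniq\<close> every other pair has a different scalar and so contributes nothing.\<close>
  have single: "x\<^sup>2 = g (lam\<^sup>2) (mu\<^sup>2) \<Longrightarrow> eig_mult M x = ?f M x"
    "eig_mult (M ** M) (g (lam\<^sup>2) (mu\<^sup>2)) = ?f (M ** M) (g (lam\<^sup>2) (mu\<^sup>2))"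
    if M: "M \<in> {C, S}" and W: "\<And>a b. W a b \<subseteq> eigenspace (M ** M) (g a b)"
      and uniq: "\<And>a b. eigenvalue (A\<^sub>1 ** A\<^sub>1) a \<Longrightarrow> eigenvalue (A\<^sub>2 ** A\<^sub>2) b \<Longrightarrow>
        g a b = g (lam\<^sup>2) (mu\<^sup>2) \<Longrightarrow> a = lam\<^sup>2 \<and> b = mu\<^sup>2"
    for M x and g :: "real \<Rightarrow> real \<Rightarrow> real"
  proof -
    have ne: "g (lam\<^sup>2) (mu\<^sup>2) \<noteq> g a b"
      if "eigenvalue (A\<^sub>1 ** A\<^sub>1) a" "eigenvalue (A\<^sub>2 ** A\<^sub>2) b" "(a, b) \<noteq> (lam\<^sup>2, mu\<^sup>2)" for a b
      using uniq[OF that(1,2)] that(3) by metis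
    show "eig_mult M x = ?f M x" if x: "x\<^sup>2 = g (lam\<^sup>2) (mu\<^sup>2)"
    proof (rule eig_mult_eq_single[OF _ _ assms(10,12)])
      show "M ** X = X ** M" "M ** Y = Y ** M" using M comm by auto
      show "eig_mult_from A\<^sub>1 A\<^sub>2 a b M x = 0"
        if "eigenvalue (A\<^sub>1 ** A\<^sub>1) a" "eigenvalue (A\<^sub>2 ** A\<^sub>2) b" "(a, b) \<noteq> (lam\<^sup>2, mu\<^sup>2)" for a b
        using ne[OF that] by (intro eig_mult_from_sq_eq_0[OF W]) (simp add: x)
    qed
    show "eig_mult (M ** M) (g (lam\<^sup>2) (mu\<^sup>2)) = ?f (M ** M) (g (lam\<^sup>2) (mu\<^sup>2))"
    proof (rule eig_mult_eq_single[OF _ _ assms(10,12)])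
      show "M ** M ** X = X ** (M ** M)" "M ** M ** Y = Y ** (M ** M)" using M comm by auto
      show "eig_mult_from A\<^sub>1 A\<^sub>2 a b (M ** M) (g (lam\<^sup>2) (mu\<^sup>2)) = 0"
        if "eigenvalue (A\<^sub>1 ** A\<^sub>1) a" "eigenvalue (A\<^sub>2 ** A\<^sub>2) b" "(a, b) \<noteq> (lam\<^sup>2, mu\<^sup>2)" for a b
        using ne[OF that] by (rule eig_mult_from_eq_0[OF W])
    qed
  qed
  have uniq_C: "(\<forall>a b. eigenvalue (A\<^sub>1 ** A\<^sub>1) a \<and> eigenvalue (A\<^sub>2 ** A\<^sub>2) b \<and> a + b = lam\<^sup>2 + mu\<^sup>2 \<longrightarrow>
      a = lam\<^sup>2 \<and> b = mu\<^sup>2) \<longrightarrow>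
      eig_mult (C ** C) (lam\<^sup>2 + mu\<^sup>2) = p * q \<and>
      (lam = 0 \<and> mu \<noteq> 0 \<longrightarrow> real (eig_mult C mu) = ?plus \<and> real (eig_mult C (- mu)) = ?minus) \<and>
      (lam \<noteq> 0 \<longrightarrow> real (eig_mult C (sqrt (lam\<^sup>2 + mu\<^sup>2))) = real p * real q / 2 \<and>
        real (eig_mult C (- sqrt (lam\<^sup>2 + mu\<^sup>2))) = real p * real q / 2)"
  proof (rule impI)
    assume hyp: "\<forall>a b. eigenvalue (A\<^sub>1 ** A\<^sub>1) a \<and> eigenvalue (A\<^sub>2 ** A\<^sub>2) b \<and> a + b = lam\<^sup>2 + mu\<^sup>2 \<longrightarrow>
      a = lam\<^sup>2 \<and> b = mu\<^sup>2"
    note * = single[of C "\<lambda>a b. a + b", OF _ W_subset_cartesian_sq[folded C]]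
    have "eig_mult (C ** C) (lam\<^sup>2 + mu\<^sup>2) = p * q"
      using *(2) hyp sq_C by simp
    moreover have eq: "eig_mult C x = ?f C x" if "x\<^sup>2 = lam\<^sup>2 + mu\<^sup>2" for x
      using *(1)[of x] hyp that by simp
    \<comment> \<open>For \<open>lam = 0\<close> both \<open>mu\<close> and \<open>- mu\<close>
      square to \<open>lam\<^sup>2 + mu\<^sup>2\<close>, so (ii) is covered by the same uniqueness
      hypothesis.\<close>
    have "eig_mult C mu = ?f C mu \<and> eig_mult C (- mu) = ?f C (- mu)" if "lam = 0"
      using that by (simp add: eq)
    moreover have "eig_mult C \<nu> = ?f C \<nu>" if "\<nu> \<in> {sqrt (lam\<^sup>2 + mu\<^sup>2), - sqrt (lam\<^sup>2 + mu\<^sup>2)}" for \<nu>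
      by (rule eq[OF sqrt_C[OF that]])
    ultimately show "eig_mult (C ** C) (lam\<^sup>2 + mu\<^sup>2) = p * q \<and>
      (lam = 0 \<and> mu \<noteq> 0 \<longrightarrow> real (eig_mult C mu) = ?plus \<and> real (eig_mult C (- mu)) = ?minus) \<and>
      (lam \<noteq> 0 \<longrightarrow> real (eig_mult C (sqrt (lam\<^sup>2 + mu\<^sup>2))) = real p * real q / 2 \<and>
        real (eig_mult C (- sqrt (lam\<^sup>2 + mu\<^sup>2))) = real p * real q / 2)"
      using kernel[of C] nz_C by simp
  qed
  have uniq_S: "(\<forall>a b. eigenvalue (A\<^sub>1 ** A\<^sub>1) a \<and> eigenvalue (A\<^sub>2 ** A\<^sub>2) b \<and> (a + 1) * b = (lam\<^sup>2 + 1) * mu\<^sup>2 \<longrightarrow>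
      a = lam\<^sup>2 \<and> b = mu\<^sup>2) \<longrightarrow>
      eig_mult (S ** S) ((lam\<^sup>2 + 1) * mu\<^sup>2) = p * q \<and>
      (lam = 0 \<and> mu \<noteq> 0 \<longrightarrow> real (eig_mult S mu) = ?plus \<and> real (eig_mult S (- mu)) = ?minus) \<and>
      (lam * mu \<noteq> 0 \<longrightarrow> real (eig_mult S (sqrt ((lam\<^sup>2 + 1) * mu\<^sup>2))) = real p * real q / 2 \<and>
        real (eig_mult S (- sqrt ((lam\<^sup>2 + 1) * mu\<^sup>2))) = real p * real q / 2)"
  proof (rule impI)
    assume hyp: "\<forall>a b. eigenvalue (A\<^sub>1 ** A\<^sub>1) a \<and> eigenvalue (A\<^sub>2 ** A\<^sub>2) b \<and> (a + 1) * b = (lam\<^sup>2 + 1) * mu\<^sup>2 \<longrightarrow>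
      a = lam\<^sup>2 \<and> b = mu\<^sup>2"
    note * = single[of S "\<lambda>a b. (a + 1) * b", OF _ W_subset_semistrong_sq[folded S]]
    have "eig_mult (S ** S) ((lam\<^sup>2 + 1) * mu\<^sup>2) = p * q"
      using *(2) hyp sq_S by simp
    moreover have eq: "eig_mult S x = ?f S x" if "x\<^sup>2 = (lam\<^sup>2 + 1) * mu\<^sup>2" for x
      using *(1)[of x] hyp that by simp
    have "eig_mult S mu = ?f S mu \<and> eig_mult S (- mu) = ?f S (- mu)" if "lam = 0"
      using that by (simp add: eq)
    moreover have "eig_mult S \<nu> = ?f S \<nu>" if "\<nu> \<in> {sqrt ((lam\<^sup>2 + 1) * mu\<^sup>2), - sqrt ((lam\<^sup>2 + 1) * mu\<^sup>2)}" for \<nu>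
      by (rule eq[OF sqrt_S[OF that]])
    ultimately show "eig_mult (S ** S) ((lam\<^sup>2 + 1) * mu\<^sup>2) = p * q \<and>
      (lam = 0 \<and> mu \<noteq> 0 \<longrightarrow> real (eig_mult S mu) = ?plus \<and> real (eig_mult S (- mu)) = ?minus) \<and>
      (lam * mu \<noteq> 0 \<longrightarrow> real (eig_mult S (sqrt ((lam\<^sup>2 + 1) * mu\<^sup>2))) = real p * real q / 2 \<and>
        real (eig_mult S (- sqrt ((lam\<^sup>2 + 1) * mu\<^sup>2))) = real p * real q / 2)"
      using kernel[of S] nz_S by simp
  qed
  show ?thesis
  proof (intro conjI)
    show "eigenvalue (C ** C) (lam\<^sup>2 + mu\<^sup>2)" "eigenvalue (S ** S) ((lam\<^sup>2 + 1) * mu\<^sup>2)"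
      using sq_C sq_S pq by (auto intro!: evI)
    show "lam = 0 \<and> mu \<noteq> 0 \<longrightarrow>
        (\<forall>M\<in>{C, S}. real (?f M mu) = ?plus \<and> real (?f M (- mu)) = ?minus)"
      using kernel by blast
    show "lam \<noteq> 0 \<longrightarrow> (\<forall>\<nu>\<in>{sqrt (lam\<^sup>2 + mu\<^sup>2), - sqrt (lam\<^sup>2 + mu\<^sup>2)}.
        eigenvalue C \<nu> \<and> real (?f C \<nu>) = real p * real q / 2)"
      using nz_C by blast
    show "lam * mu \<noteq> 0 \<longrightarrow>
        (\<forall>\<nu>\<in>{sqrt ((lam\<^sup>2 + 1) * mu\<^sup>2), - sqrt ((lam\<^sup>2 + 1) * mu\<^sup>2)}.
        eigenvalue S \<nu> \<and> real (?f S \<nu>) = real p * real q / 2)"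
      using nz_S by blast
  qed (fact sq_C sq_S total uniq_C uniq_S)+
qed

end
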